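(* Let $a$ satisfy assumption (b) of the context. Then the fundamental solution of the equation $\frac{\partial u}{\partial t}-a(t)\Delta_x u=f$ can be represented as $$\varepsilon_{n,b}(x,t):=\varepsilon_n\big(x,a_1(t)\big)=\frac{\theta(t)\,e^{-\frac{|x|^2}{4a_1(t)}}}{\big(4\pi a_1(t)\big)^{n/2}},\qquad (x,t)\in\mathbb{R}^n\times(-\infty,T),$$ that is, $\varepsilon=\varepsilon_{n,b}$ satisfies, in the sense of distributions, $\frac{\partial\varepsilon(x,t)}{\partial t}-a(t)\Delta_x\varepsilon(x,t)=\delta(x)\delta(t)$ on $\mathbb{R}^n\times(-\infty,T)$.
   Context: Setting: $0<T<\infty$, $n\ge2$, and the coefficient $a\in L_1[0,T]$ is defined on $[0,T]$. Assumption (b): the function $a_1(t):=\int_0^t a(z)\,dz$ is positive for all $t>0$ (so $a$ may be negative in an interval). $\varepsilon_n(x,t)=\theta(t)(4\pi t)^{-n/2}e^{-|x|^2/(4t)}$ is the fundamental solution of the standard heat operator $\partial_t-\Delta_x$, $\theta$ is the Heaviside function (so the expression $\varepsilon_{n,b}(x,t)$ is $0$ for $t<0$), $|x|$ is the Euclidean norm, and $\delta$ is the Dirac distribution. *)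

theory Defs
  imports "HOL-Analysis.Analysis"
begin

section \<open>Distributions on an open set\<close>

definition partial_deriv :: "'a \<Rightarrow> ('a::euclidean_space \<Rightarrow> real) \<Rightarrow> 'a \<Rightarrow> real" where
  "partial_deriv b f x = frechet_derivative f (at x) b"

primrec iter_partial :: "'a list \<Rightarrow> ('a::euclidean_space \<Rightarrow> real) \<Rightarrow> 'a \<Rightarrow> real" where
  "iter_partial [] f = f"
| "iter_partial (b # bs) f = partial_deriv b (iter_partial bs f)"

text \<open>Every iterated partial derivative being (Frechet) differentiable everywhere makes all of
  them continuous, so this is the usual class of infinitely differentiable functions.\<close>

definition smooth :: "('a::euclidean_space \<Rightarrow> real) \<Rightarrow> bool" where
  "smooth f \<longleftrightarrow> (\<forall>bs\<in>lists Basis. \<forall>x. iter_partial bs f differentiable (at x))"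

definition supp :: "('a::topological_space \<Rightarrow> real) \<Rightarrow> 'a set" where
  "supp f = closure {x. f x \<noteq> 0}"

text \<open>Test functions on \<open>\<Omega>\<close> are represented by their extension by zero to the whole space.\<close>

definition test_functions :: "'a::euclidean_space set \<Rightarrow> ('a \<Rightarrow> real) set" where
  "test_functions \<Omega> = {\<phi>. smooth \<phi> \<and> compact (supp \<phi>) \<and> supp \<phi> \<subseteq> \<Omega>}"

text \<open>A distribution is a linear functional on the test functions that is continuous, in the form
  of the usual seminorm estimate on each compact subset; \<open>M\<close> ranges over the common upper bounds of
  the derivatives of order at most \<open>N\<close>. Values outside \<open>test_functions \<Omega>\<close> are irrelevant.\<close>

definition distribution :: "'a::euclidean_space set \<Rightarrow> (('a \<Rightarrow> real) \<Rightarrow> real) \<Rightarrow> bool" where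
  "distribution \<Omega> u \<longleftrightarrow>
     (\<forall>\<phi>\<in>test_functions \<Omega>. \<forall>\<psi>\<in>test_functions \<Omega>. u (\<lambda>x. \<phi> x + \<psi> x) = u \<phi> + u \<psi>) \<and>
     (\<forall>\<phi>\<in>test_functions \<Omega>. \<forall>c. u (\<lambda>x. c * \<phi> x) = c * u \<phi>) \<and>
     (\<forall>K. compact K \<and> K \<subseteq> \<Omega> \<longrightarrow>
        (\<exists>C N. \<forall>\<phi>\<in>test_functions \<Omega>. supp \<phi> \<subseteq> K \<longrightarrow>
           (\<forall>M. (\<forall>bs\<in>lists Basis. length bs \<le> N \<longrightarrow> (\<forall>x. \<bar>iter_partial bs \<phi> x\<bar> \<le> M))
              \<longrightarrow> \<bar>u \<phi>\<bar> \<le> C * M)))"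

definition locally_integrable :: "'a::euclidean_space set \<Rightarrow> ('a \<Rightarrow> real) \<Rightarrow> bool" where
  "locally_integrable \<Omega> f \<longleftrightarrow> (\<forall>K. compact K \<and> K \<subseteq> \<Omega> \<longrightarrow> set_integrable lebesgue K f)"

definition regular_dist ::
  "'a::euclidean_space set \<Rightarrow> ('a \<Rightarrow> real) \<Rightarrow> ('a \<Rightarrow> real) \<Rightarrow> real" where
  "regular_dist \<Omega> f \<phi> = set_lebesgue_integral lebesgue \<Omega> (\<lambda>z. f z * \<phi> z)"

definition dist_partial ::
  "'a \<Rightarrow> (('a::euclidean_space \<Rightarrow> real) \<Rightarrow> real) \<Rightarrow> ('a \<Rightarrow> real) \<Rightarrow> real" where
  "dist_partial b u \<phi> = - u (partial_deriv b \<phi>)"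

definition dirac :: "('a::zero \<Rightarrow> real) \<Rightarrow> real" where
  "dirac \<phi> = \<phi> 0"

definition dist_tensor ::
  "(('a \<Rightarrow> real) \<Rightarrow> real) \<Rightarrow> (('b \<Rightarrow> real) \<Rightarrow> real) \<Rightarrow> ('a \<times> 'b \<Rightarrow> real) \<Rightarrow> real" where
  "dist_tensor u v \<phi> = u (\<lambda>x. v (\<lambda>t. \<phi> (x, t)))"

section \<open>The equation \<open>u\<^sub>t - a(t) \<Delta>\<^sub>x u = f\<close>\<close>

definition dist_t_deriv ::
  "(((real ^ 'n) \<times> real \<Rightarrow> real) \<Rightarrow> real) \<Rightarrow> ((real ^ 'n) \<times> real \<Rightarrow> real) \<Rightarrow> real" where
  "dist_t_deriv u = dist_partial (0, 1) u"

definition dist_x_laplacian ::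
  "(((real ^ 'n) \<times> real \<Rightarrow> real) \<Rightarrow> real) \<Rightarrow> ((real ^ 'n) \<times> real \<Rightarrow> real) \<Rightarrow> real" where
  "dist_x_laplacian u \<phi> =
     (\<Sum>i\<in>UNIV. dist_partial (axis i 1, 0) (dist_partial (axis i 1, 0) u) \<phi>)"

text \<open>For merely integrable \<open>a\<close>, the product of \<open>a(t)\<close> with the distribution \<open>\<Delta>\<^sub>x \<epsilon>\<close> is not
  covered by multiplication with smooth functions. As \<open>a\<close> does not depend on \<open>x\<close>, it is understood
  as \<open>\<Delta>\<^sub>x (a \<epsilon>)\<close>, where the locally integrable function \<open>a \<epsilon>\<close> is regarded as a distribution.
  The integrability requirements matter because integrals of non-integrable functions are \<open>0\<close>
  by convention.\<close>

definition fundamental_solution ::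
  "real \<Rightarrow> (real \<Rightarrow> real) \<Rightarrow> ((real ^ 'n) \<times> real \<Rightarrow> real) \<Rightarrow> bool" where
  "fundamental_solution T a \<epsilon> \<longleftrightarrow>
     (let \<Omega> = UNIV \<times> {..<T}; a\<epsilon> = (\<lambda>(x, t). a t * \<epsilon> (x, t)) in
        locally_integrable \<Omega> \<epsilon> \<and> distribution \<Omega> (regular_dist \<Omega> \<epsilon>) \<and>
        locally_integrable \<Omega> a\<epsilon> \<and> distribution \<Omega> (regular_dist \<Omega> a\<epsilon>) \<and>
        (\<forall>\<phi>\<in>test_functions \<Omega>.
           dist_t_deriv (regular_dist \<Omega> \<epsilon>) \<phi> - dist_x_laplacian (regular_dist \<Omega> a\<epsilon>) \<phi>
           = dist_tensor dirac dirac \<phi>))"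

definition heaviside :: "real \<Rightarrow> real" where
  "heaviside t = (if 0 < t then 1 else 0)"

definition heat_kernel :: "real ^ 'n \<Rightarrow> real \<Rightarrow> real" where
  "heat_kernel x t =
     heaviside t * (4 * pi * t) powr (- real CARD('n) / 2) * exp (- (norm x)\<^sup>2 / (4 * t))"

text \<open>For \<open>t < 0\<close> the interval \<open>{0..t}\<close> is empty, so \<open>a\<^sub>1(t) = 0\<close>: the coefficient, given on
  \<open>[0,T]\<close> only, is in effect continued by \<open>0\<close>. Hence \<open>heat_kernel_coeff a x t = 0\<close> for \<open>t \<le> 0\<close>,
  and values of \<open>a\<close> on the negative axis do not enter the equation.\<close>

definition primitive0 :: "(real \<Rightarrow> real) \<Rightarrow> real \<Rightarrow> real" where
  "primitive0 a t = set_lebesgue_integral lebesgue {0..t} a"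

definition heat_kernel_coeff :: "(real \<Rightarrow> real) \<Rightarrow> real ^ 'n \<Rightarrow> real \<Rightarrow> real" where
  "heat_kernel_coeff a x t = heat_kernel x (primitive0 a t)"

end

theory Submission
  imports Defs "HOL-Probability.Distributions"
begin

text \<open>
  Write \<open>A(t)\<close> for the primitive \<open>a\<^sub>1(t)\<close>. The heat kernel \<open>\<epsilon>\<^sub>n(x, s)\<close> solves \<open>\<partial>\<^sub>s \<epsilon>\<^sub>n = \<Delta> \<epsilon>\<^sub>n\<close> for
  \<open>s > 0\<close>, so that formally \<open>\<partial>\<^sub>t (\<epsilon>\<^sub>n(x, A(t))) = a(t) \<Delta> \<epsilon>\<^sub>n(x, A(t))\<close> for \<open>t > 0\<close>, and the Dirac mass at
  the origin comes from \<open>\<epsilon>\<^sub>n(\<cdot>, s) \<longrightarrow> \<delta>\<close> as \<open>s \<longrightarrow> 0\<close>. Positivity of \<open>A\<close> keeps the kernel in the region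
  \<open>s > 0\<close> at all times \<open>0 < t \<le> T\<close>, whatever the sign of \<open>a\<close>.

  The one delicate point is that \<open>a\<close> is only integrable, so that \<open>A\<close> is absolutely continuous but need
  not be differentiable at a given time. For each fixed \<open>x\<close>, the product \<open>\<phi>(x, t) \<epsilon>\<^sub>n(x, A(t))\<close>
  nevertheless equals the integral of its formal derivative over \<open>[\<eta>, T]\<close> when \<open>\<eta> > 0\<close>: this is
  \<open>chain_rule_along_primitive\<close>, which measures all errors by \<open>\<integral> (1 + \<bar>a\<bar>)\<close> instead of the length of
  the time interval. As \<open>\<phi>\<close> vanishes at \<open>t = T\<close>, the only boundary term is \<open>- \<phi>(x, \<eta>) \<epsilon>\<^sub>n(x, A(\<eta>))\<close>.

  Integration over \<open>x\<close>, Fubini's theorem, and a transfer of the Laplacian from the kernel to \<open>\<phi>\<close> at each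
  fixed time (\<open>heat_kernel_transfer_laplacian\<close>) turn this into
  \<open>\<integral>\<^sub>\<eta>\<^sup>T \<integral> (\<phi>\<^sub>t + a \<Delta>\<phi>) \<epsilon>\<^sub>n(x, A(t)) dx dt = - \<integral> \<phi>(x, \<eta>) \<epsilon>\<^sub>n(x, A(\<eta>)) dx\<close>,
  which is \<open>weak_integral_slab\<close>. The kernel has total mass 1 at each time, hence the integrand on the
  left is integrable up to \<open>t = 0\<close> and dominated convergence applies as \<open>\<eta> \<longrightarrow> 0\<close>; on the right the
  substitution \<open>x = \<surd>s y\<close> gives the limit \<open>- \<phi>(0, 0)\<close> (\<open>heat_kernel_approximate_identity\<close>). This is the
  equation tested against \<open>\<phi>\<close>. The mass bound also makes the kernel and its product with \<open>a\<close> integrable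
  on \<open>\<real>\<^sup>n \<times> (-\<infinity>, T)\<close>, so both define distributions of order 0.
\<close>

section \<open>The chain rule along the primitive of an integrable function\<close>

text \<open>Differentiability of \<open>k\<close> at \<open>(x, A x)\<close> bounds the increment of \<open>k (t, A t)\<close> minus its linear part,
  over short intervals around \<open>x\<close>, by \<open>e (\<bar>t - x\<bar> + \<bar>A t - A x\<bar>)\<close>, hence by \<open>e \<integral> (1 + \<bar>a\<bar>)\<close>; continuity
  of \<open>g1\<close> and \<open>g2\<close> bounds the error of the integral in the same way. These bounds are additive over
  adjacent intervals, so they hold on \<open>{u..v}\<close> by bisection, and \<open>e\<close> is arbitrary. In this way \<open>A\<close> need
  not be differentiated anywhere.\<close>

lemma chain_rule_along_primitive:
  fixes a A g1 g2 :: "real \<Rightarrow> real" and k :: "real \<times> real \<Rightarrow> real"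
  assumes "u \<le> v"
    and a: "a absolutely_integrable_on {u..v}"
    and A: "\<And>s t. u \<le> s \<Longrightarrow> s \<le> t \<Longrightarrow> t \<le> v \<Longrightarrow> A t - A s = integral {s..t} a"
    and k: "\<And>t. u \<le> t \<Longrightarrow> t \<le> v \<Longrightarrow>
      (k has_derivative (\<lambda>h. g1 t * fst h + g2 t * snd h)) (at (t, A t))"
    and g1: "continuous_on {u..v} g1" and g2: "continuous_on {u..v} g2"
  shows "integral {u..v} (\<lambda>r. g1 r + a r * g2 r) = k (v, A v) - k (u, A u)"
proof -
  let ?w = "\<lambda>r. g1 r + a r * g2 r" and ?m = "\<lambda>r. 1 + \<bar>a r\<bar>"
  have a_int: "a integrable_on {u..v}"
    using a by (simp add: absolutely_integrable_on_def)
  have abs_a_int: "(\<lambda>r. \<bar>a r\<bar>) integrable_on {u..v}"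
    using a by (simp add: absolutely_integrable_on_def)
  have ag2: "(\<lambda>r. a r * g2 r) integrable_on {u..v}"
  proof -
    have "(\<lambda>r. g2 r * a r) absolutely_integrable_on {u..v}"
      using a g2
      by (intro absolutely_integrable_bounded_measurable_product_real
          continuous_imp_measurable_on_sets_lebesgue compact_imp_bounded compact_continuous_image) auto
    then show ?thesis by (simp add: absolutely_integrable_on_def mult.commute)
  qed
  have w_int: "?w integrable_on {s..t}" if "u \<le> s" "t \<le> v" for s t
    by (rule integrable_on_subinterval[OF integrable_add[OF integrable_continuous_interval[OF g1] ag2]])
      (use that in auto)
  have m_int: "?m integrable_on {s..t}" if "u \<le> s" "t \<le> v" for s t
    by (rule integrable_on_subinterval[OF integrable_add[OF integrable_const_ivl abs_a_int]])
      (use that in auto)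
  have a_int': "a integrable_on {s..t}" "(\<lambda>r. \<bar>a r\<bar>) integrable_on {s..t}" if "u \<le> s" "t \<le> v" for s t
    using that by (auto intro: integrable_on_subinterval[OF a_int] integrable_on_subinterval[OF abs_a_int])
  have ag2': "(\<lambda>r. a r * g2 r) integrable_on {s..t}" "g1 integrable_on {s..t}" if "u \<le> s" "t \<le> v" for s t
    using that by (auto intro: integrable_on_subinterval[OF ag2]
        integrable_on_subinterval[OF integrable_continuous_interval[OF g1]])
  \<comment> \<open>The measure with density \<open>1 + \<bar>a\<bar>\<close> dominates the increments of both time and \<open>A\<close>.\<close>
  have m_ge: "\<bar>t - s\<bar> + \<bar>A t - A s\<bar> \<le> integral {s..t} ?m" if "u \<le> s" "s \<le> t" "t \<le> v" for s t
  proof -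
    have "\<bar>A t - A s\<bar> \<le> integral {s..t} (\<lambda>r. \<bar>a r\<bar>)"
      using integral_norm_bound_integral[of a "{s..t}" "\<lambda>r. \<bar>a r\<bar>"] a_int'[of s t] A[of s t] that by simp
    moreover have "integral {s..t} ?m = (t - s) + integral {s..t} (\<lambda>r. \<bar>a r\<bar>)"
      using that a_int'[of s t] by (subst integral_add) auto
    ultimately show ?thesis using that by simp
  qed
  have A_cont: "continuous_on {u..v} A"
  proof -
    have "continuous_on {u..v} (\<lambda>t. A u + integral {u..t} a)"
      by (intro continuous_intros indefinite_integral_continuous_1 a_int)
    moreover have "A u + integral {u..t} a = A t" if "t \<in> {u..v}" for t
      using A[of u t] that by simp
    ultimately show ?thesis by (subst continuous_on_cong[of _ _ _ "\<lambda>t. A u + integral {u..t} a"]) auto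
  qed
  have bound: "\<bar>k (v, A v) - k (u, A u) - integral {u..v} ?w\<bar> \<le> 2 * e * integral {u..v} ?m"
    if "e > 0" for e
  proof -
    \<comment> \<open>One \<open>e\<close> is spent on the Taylor error of \<open>k\<close>, the other on freezing \<open>g1\<close> and \<open>g2\<close> at \<open>x\<close>.\<close>
    define P where "P s t \<longleftrightarrow> (u \<le> s \<longrightarrow> t \<le> v \<longrightarrow>
       \<bar>k (t, A t) - k (s, A s) - integral {s..t} ?w\<bar> \<le> 2 * e * integral {s..t} ?m)" for s t
    have "P u v"
      using \<open>u \<le> v\<close>
    proof (induct rule: Bolzano)
      case (trans s x t)
      show ?case unfolding P_def
      proof (intro impI)
        assume *: "u \<le> s" "t \<le> v"
        have "integral {s..t} ?w = integral {s..x} ?w + integral {x..t} ?w"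
          using trans * by (intro Henstock_Kurzweil_Integration.integral_combine[symmetric] w_int) auto
        moreover have "integral {s..t} ?m = integral {s..x} ?m + integral {x..t} ?m"
          using trans * by (intro Henstock_Kurzweil_Integration.integral_combine[symmetric] m_int) auto
        ultimately show "\<bar>k (t, A t) - k (s, A s) - integral {s..t} ?w\<bar> \<le> 2 * e * integral {s..t} ?m"
          using trans * unfolding P_def by (simp add: distrib_left)
      qed
    next
      case (local x)
      from k[of x] local \<open>e > 0\<close> obtain d1 where d1: "d1 > 0"
        "\<And>p. norm (p - (x, A x)) < d1 \<Longrightarrow>
          \<bar>k p - k (x, A x) - (g1 x * fst (p - (x, A x)) + g2 x * snd (p - (x, A x)))\<bar> \<le> e * norm (p - (x, A x))"
        unfolding has_derivative_at_alt real_norm_def by meson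
      have x: "x \<in> {u..v}" using local by simp
      from A_cont[unfolded continuous_on_iff, rule_format, OF x, of "d1/2"] d1(1) obtain d2 where d2: "d2 > 0"
        "\<And>y. y \<in> {u..v} \<Longrightarrow> \<bar>y - x\<bar> < d2 \<Longrightarrow> \<bar>A y - A x\<bar> < d1/2"
        by (auto simp: dist_real_def)
      from g1[unfolded continuous_on_iff, rule_format, OF x, of e] \<open>e > 0\<close> obtain d3 where d3: "d3 > 0"
        "\<And>y. y \<in> {u..v} \<Longrightarrow> \<bar>y - x\<bar> < d3 \<Longrightarrow> \<bar>g1 y - g1 x\<bar> < e"
        by (auto simp: dist_real_def)
      from g2[unfolded continuous_on_iff, rule_format, OF x, of e] \<open>e > 0\<close> obtain d4 where d4: "d4 > 0"
        "\<And>y. y \<in> {u..v} \<Longrightarrow> \<bar>y - x\<bar> < d4 \<Longrightarrow> \<bar>g2 y - g2 x\<bar> < e"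
        by (auto simp: dist_real_def)
      define d where "d = Min {d1/2, d2, d3, d4}"
      have d: "d > 0" "d \<le> d1/2" "d \<le> d2" "d \<le> d3" "d \<le> d4"
        using d1(1) d2(1) d3(1) d4(1) by (auto simp: d_def)
      have taylor: "\<bar>k (y, A y) - k (x, A x) - (g1 x * (y - x) + g2 x * (A y - A x))\<bar> \<le> e * (\<bar>y - x\<bar> + \<bar>A y - A x\<bar>)"
        if y: "y \<in> {u..v}" "\<bar>y - x\<bar> < d" for y
      proof -
        have n: "norm ((y, A y) - (x, A x)) \<le> \<bar>y - x\<bar> + \<bar>A y - A x\<bar>"
          using norm_Pair_le[of "y - x" "A y - A x"] by simp
        have "\<bar>A y - A x\<bar> < d1/2" using d2(2)[OF y(1)] y(2) d by simp
        then have "norm ((y, A y) - (x, A x)) < d1" using n y(2) d by simp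
        from d1(2)[OF this] have "\<bar>k (y, A y) - k (x, A x) - (g1 x * (y - x) + g2 x * (A y - A x))\<bar> \<le> e * norm ((y, A y) - (x, A x))"
          by simp
        also have "\<dots> \<le> e * (\<bar>y - x\<bar> + \<bar>A y - A x\<bar>)" using n \<open>e > 0\<close> by (intro mult_left_mono) auto
        finally show ?thesis .
      qed
      have "P s t" if st: "s \<le> x" "x \<le> t" "t - s < d" for s t
        unfolding P_def
      proof (intro impI)
        assume *: "u \<le> s" "t \<le> v"
        let ?lin = "g1 x * (t - s) + g2 x * (A t - A s)"
        have 1: "\<bar>k (t, A t) - k (x, A x) - (g1 x * (t - x) + g2 x * (A t - A x))\<bar> \<le> e * integral {x..t} ?m"
          by (rule order_trans[OF taylor mult_left_mono[OF m_ge]]) (use st * local \<open>e > 0\<close> in auto)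
        have 2: "\<bar>k (s, A s) - k (x, A x) - (g1 x * (s - x) + g2 x * (A s - A x))\<bar> \<le> e * integral {s..x} ?m"
          using st * local \<open>e > 0\<close>
          by (intro order_trans[OF taylor[of s]], simp, simp)
             (subst abs_minus_commute, subst (2) abs_minus_commute, intro mult_left_mono m_ge, auto)
        have m_split: "integral {s..t} ?m = integral {s..x} ?m + integral {x..t} ?m"
          using st * by (intro Henstock_Kurzweil_Integration.integral_combine[symmetric] m_int) auto
        have "\<bar>integral {s..t} ?w - ?lin\<bar> \<le> integral {s..t} (\<lambda>r. e * ?m r)"
        proof -
          have "((\<lambda>r. ?w r - (g1 x + g2 x * a r)) has_integral
             (integral {s..t} ?w - (g1 x * (t - s) + g2 x * integral {s..t} a))) {s..t}"
            using st * has_integral_const_real[of "g1 x" s t]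
            by (intro has_integral_diff has_integral_add has_integral_mult_right integrable_integral w_int a_int')
               (auto simp: mult.commute)
          then have "integral {s..t} (\<lambda>r. ?w r - (g1 x + g2 x * a r)) = integral {s..t} ?w - ?lin"
            and i: "(\<lambda>r. ?w r - (g1 x + g2 x * a r)) integrable_on {s..t}"
            using A[of s t] st * by (auto simp: integral_unique has_integral_integrable)
          moreover have "norm (integral {s..t} (\<lambda>r. ?w r - (g1 x + g2 x * a r))) \<le> integral {s..t} (\<lambda>r. e * ?m r)"
          proof (rule integral_norm_bound_integral[OF i])
            show "(\<lambda>r. e * ?m r) integrable_on {s..t}" 
              using integrable_on_cmult_left[OF m_int, of s t e] * by simp
            fix r assume r: "r \<in> {s..t}"
            then have r': "r \<in> {u..v}" "\<bar>r - x\<bar> < d" using st * by auto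
            have "norm (?w r - (g1 x + g2 x * a r)) = \<bar>(g1 r - g1 x) + a r * (g2 r - g2 x)\<bar>"
              by (simp add: algebra_simps)
            also have "\<dots> \<le> \<bar>g1 r - g1 x\<bar> + \<bar>a r\<bar> * \<bar>g2 r - g2 x\<bar>"
              by (metis abs_mult abs_triangle_ineq)
            also have "\<dots> \<le> e + \<bar>a r\<bar> * e"
              using d3(2)[OF r'(1)] d4(2)[OF r'(1)] r'(2) d by (intro add_mono mult_left_mono) auto
            finally show "norm (?w r - (g1 x + g2 x * a r)) \<le> e * ?m r" by (simp add: algebra_simps)
          qed
          ultimately show ?thesis by simp
        qed
        then have 3: "\<bar>integral {s..t} ?w - ?lin\<bar> \<le> e * integral {s..t} ?m" by simp
        have "?lin = (g1 x * (t - x) + g2 x * (A t - A x)) - (g1 x * (s - x) + g2 x * (A s - A x))"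
          by (simp add: algebra_simps)
        with 1 2 3 show "\<bar>k (t, A t) - k (s, A s) - integral {s..t} ?w\<bar> \<le> 2 * e * integral {s..t} ?m"
          unfolding m_split by (simp add: distrib_left)
      qed
      with d(1) show ?case by blast
    qed
    then show ?thesis by (simp add: P_def)
  qed
  have "\<bar>k (v, A v) - k (u, A u) - integral {u..v} ?w\<bar> \<le> 0"
  proof (rule field_le_epsilon)
    fix e :: real assume e: "e > 0"
    have m0: "integral {u..v} ?m \<ge> 0" by (intro integral_nonneg m_int) auto
    have "2 * (e / (2 * (integral {u..v} ?m + 1))) * integral {u..v} ?m \<le> e"
      using m0 e by (simp add: field_simps)
    with bound[of "e / (2 * (integral {u..v} ?m + 1))"] e m0
    show "\<bar>k (v, A v) - k (u, A u) - integral {u..v} ?w\<bar> \<le> 0 + e" by simp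
  qed
  then show ?thesis by simp
qed

section \<open>Integrals over Euclidean spaces and their products\<close>

lemma integrable_continuous_vanishing_far:
  fixes f :: "'a::euclidean_space \<Rightarrow> real"
  assumes "continuous_on UNIV f" "\<And>x. R < norm x \<Longrightarrow> f x = 0"
  shows "integrable lborel f"
proof -
  have "f x = indicator (cball 0 R) x *\<^sub>R f x" for x
    using assms(2)[of x] by (auto simp: indicator_def)
  moreover have "integrable lborel (\<lambda>x. indicator (cball 0 R) x *\<^sub>R f x)"
    by (rule borel_integrable_compact[OF compact_cball continuous_on_subset[OF assms(1)]]) simp
  ultimately show ?thesis by (subst Bochner_Integration.integrable_cong[OF refl]) auto
qed

text \<open>By translation invariance all difference quotients of \<open>f\<close> in direction \<open>e\<close> have integral 0, and
  they converge to \<open>f'\<close> boundedly and within a fixed ball. This is the form of integration by parts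
  used below: it needs no splitting of the space into a line and a hyperplane.\<close>

lemma integral_directional_derivative_eq_0:
  fixes f f' :: "'a::euclidean_space \<Rightarrow> real"
  assumes deriv: "\<And>x. ((\<lambda>h. f (x + h *\<^sub>R e)) has_real_derivative f' x) (at 0)"
    and f: "continuous_on UNIV f" and f': "continuous_on UNIV f'"
    and f0: "\<And>x. R < norm x \<Longrightarrow> f x = 0" and f'0: "\<And>x. R < norm x \<Longrightarrow> f' x = 0"
  shows "(\<integral>x. f' x \<partial>lborel) = 0"
proof -
  have deriv': "((\<lambda>h. f (x + h *\<^sub>R e)) has_real_derivative f' (x + h *\<^sub>R e)) (at h)" for x h
  proof -
    have "((\<lambda>d. f ((x + h *\<^sub>R e) + d *\<^sub>R e)) has_real_derivative f' (x + h *\<^sub>R e)) (at 0)"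
      by (rule deriv)
    then show ?thesis
      using DERIV_shift[of "\<lambda>h. f (x + h *\<^sub>R e)" "f' (x + h *\<^sub>R e)" 0 h]
      by (simp add: algebra_simps)
  qed
  have f_int: "integrable lborel f"
    by (rule integrable_continuous_vanishing_far[OF f f0])
  have "bounded (range f')"
  proof -
    have "range f' \<subseteq> insert 0 (f' ` cball 0 R)" using f'0 by (force simp: not_le)
    moreover have "compact (insert 0 (f' ` cball 0 R))"
      by (intro compact_insert compact_continuous_image continuous_on_subset[OF f']) auto
    ultimately show ?thesis using bounded_subset compact_imp_bounded by blast
  qed
  then obtain C where C: "\<And>x. \<bar>f' x\<bar> \<le> C" unfolding bounded_iff by auto
  have trans: "integrable lborel (\<lambda>x. f (x + c))" "(\<integral>x. f (x + c) \<partial>lborel) = (\<integral>x. f x \<partial>lborel)" for c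
  proof -
    have [measurable]: "f \<in> borel_measurable borel" using f by (rule borel_measurable_continuous_onI)
    have "integrable (distr lborel borel ((+) c)) f"
      using f_int by (simp add: lborel_distr_plus)
    then show "integrable lborel (\<lambda>x. f (x + c))"
      by (subst (asm) integrable_distr_eq) (auto simp: add.commute)
    have "(\<integral>x. f x \<partial>lborel) = (\<integral>x. f x \<partial>distr lborel borel ((+) c))"
      by (simp add: lborel_distr_plus)
    also have "\<dots> = (\<integral>x. f (x + c) \<partial>lborel)"
      by (subst integral_distr) (auto simp: add.commute)
    finally show "(\<integral>x. f (x + c) \<partial>lborel) = (\<integral>x. f x \<partial>lborel)" ..
  qed
  define h where "h m = inverse (real (Suc m))" for m
  define q where "q m x = (f (x + h m *\<^sub>R e) - f x) / h m" for m x
  have h: "h m > 0" "h m \<le> 1" for m by (auto simp: h_def inverse_le_1_iff)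
  have "(\<lambda>m. \<integral>x. q m x \<partial>lborel) \<longlonglongrightarrow> (\<integral>x. f' x \<partial>lborel)"
  proof (rule integral_dominated_convergence)
    show "f' \<in> borel_measurable lborel" using f' by (simp add: borel_measurable_continuous_onI)
    show "q m \<in> borel_measurable lborel" for m
      using f unfolding q_def
      by (auto intro!: borel_measurable_continuous_onI continuous_intros continuous_on_compose2[OF f] simp: h_def)
    show "integrable lborel (\<lambda>x. indicator (cball 0 (R + norm e)) x *\<^sub>R C)"
      by (rule borel_integrable_compact) auto
    show "AE x in lborel. (\<lambda>m. q m x) \<longlonglongrightarrow> f' x"
    proof (rule AE_I2)
      fix x
      have "((\<lambda>d. (f (x + d *\<^sub>R e) - f x) / d) \<longlongrightarrow> f' x) (at 0)"
        using deriv[of x] by (simp add: DERIV_def)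
      moreover have "filterlim h (at 0) sequentially"
        unfolding filterlim_at h_def using LIMSEQ_inverse_real_of_nat by auto
      ultimately show "(\<lambda>m. q m x) \<longlonglongrightarrow> f' x"
        unfolding q_def by (rule filterlim_compose)
    qed
    show "AE x in lborel. norm (q m x) \<le> indicator (cball 0 (R + norm e)) x *\<^sub>R C" for m
    proof (rule AE_I2)
      fix x
      show "norm (q m x) \<le> indicator (cball 0 (R + norm e)) x *\<^sub>R C"
      proof (cases "norm x \<le> R + norm e")
        case True
        obtain z where "f (x + h m *\<^sub>R e) - f (x + 0 *\<^sub>R e) = (h m - 0) * f' (x + z *\<^sub>R e)"
          using MVT2[OF h(1)[of m], of "\<lambda>d. f (x + d *\<^sub>R e)" "\<lambda>d. f' (x + d *\<^sub>R e)"] deriv' by blast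
        then have "q m x = f' (x + z *\<^sub>R e)" using h(1)[of m] by (simp add: q_def)
        with C True show ?thesis by (simp add: indicator_def)
      next
        case False
        have "norm (h m *\<^sub>R e) \<le> norm e" using h[of m] by (simp add: mult_left_le_one_le)
        then have "R < norm (x + h m *\<^sub>R e)" using False norm_diff_ineq[of x "h m *\<^sub>R e"] by linarith
        moreover have "R < norm x" using False norm_ge_zero[of e] by linarith
        ultimately show ?thesis using False f0 by (simp add: q_def)
      qed
    qed
  qed
  moreover have "(\<integral>x. q m x \<partial>lborel) = 0" for m
    unfolding q_def using trans f_int by simp
  ultimately show ?thesis by (simp add: LIMSEQ_const_iff)
qed
lemma measurable_pair_continuous:
  fixes f :: "'a::euclidean_space \<times> 'b::euclidean_space \<Rightarrow> real"
  assumes "continuous_on UNIV f"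
  shows "f \<in> borel_measurable (lborel \<Otimes>\<^sub>M lborel)"
  unfolding lborel_prod using assms by (simp add: borel_measurable_continuous_onI)

lemma integrable_bounded_mult:
  fixes g f :: "'a::euclidean_space \<times> 'b::euclidean_space \<Rightarrow> real"
  assumes "integrable (lborel \<Otimes>\<^sub>M lborel) g"
    and "f \<in> borel_measurable (lborel \<Otimes>\<^sub>M lborel)" "\<And>z. \<bar>f z\<bar> \<le> C"
  shows "integrable (lborel \<Otimes>\<^sub>M lborel) (\<lambda>z. f z * g z)"
proof (rule Bochner_Integration.integrable_bound)
  show "integrable (lborel \<Otimes>\<^sub>M lborel) (\<lambda>z. C * g z)" using assms(1) by simp
  have [measurable]: "g \<in> borel_measurable (lborel \<Otimes>\<^sub>M lborel)" using assms(1) by simp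
  show "(\<lambda>z. f z * g z) \<in> borel_measurable (lborel \<Otimes>\<^sub>M lborel)" using assms(2) by measurable
  have "\<bar>f z\<bar> \<le> \<bar>C\<bar>" for z using assms(3)[of z] by linarith
  then show "AE z in lborel \<Otimes>\<^sub>M lborel. norm (f z * g z) \<le> norm (C * g z)"
    by (auto simp: abs_mult intro!: mult_right_mono)
qed

text \<open>Tonelli's theorem: a kernel whose \<open>x\<close>-slices have uniformly bounded mass can be weighted by any
  integrable function of the remaining variable.\<close>

lemma integrable_kernel_times_snd:
  fixes k :: "'a::euclidean_space \<times> 'b::euclidean_space \<Rightarrow> real" and g :: "'b \<Rightarrow> real"
  assumes k [measurable]: "k \<in> borel_measurable (lborel \<Otimes>\<^sub>M lborel)"
    and g: "integrable lborel g"
    and bound: "\<And>t. (\<integral>\<^sup>+x. norm (k (x, t)) \<partial>lborel) \<le> ennreal C"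
  shows "integrable (lborel \<Otimes>\<^sub>M lborel) (\<lambda>z. g (snd z) * k z)"
proof (rule integrableI_bounded)
  have [measurable]: "g \<in> borel_measurable lborel" using g by auto
  show "(\<lambda>z. g (snd z) * k z) \<in> borel_measurable (lborel \<Otimes>\<^sub>M lborel)" by measurable
  have "(\<integral>\<^sup>+z. norm (g (snd z) * k z) \<partial>(lborel \<Otimes>\<^sub>M lborel)) =
      (\<integral>\<^sup>+t. \<integral>\<^sup>+x. norm (g t) * norm (k (x, t)) \<partial>lborel \<partial>lborel)"
    by (subst lborel_pair.nn_integral_snd[symmetric]) (auto simp: abs_mult)
  also have "\<dots> = (\<integral>\<^sup>+t. norm (g t) * (\<integral>\<^sup>+x. norm (k (x, t)) \<partial>lborel) \<partial>lborel)"
    by (auto simp: ennreal_mult intro!: nn_integral_cong nn_integral_cmult)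
  also have "\<dots> \<le> (\<integral>\<^sup>+t. norm (g t) * ennreal C \<partial>lborel)"
    using bound by (intro nn_integral_mono mult_left_mono) auto
  also have "\<dots> = (\<integral>\<^sup>+t. norm (g t) \<partial>lborel) * ennreal C"
    by (rule nn_integral_multc) auto
  also have "\<dots> < \<infinity>"
    using g by (auto simp: integrable_iff_bounded ennreal_mult_less_top)
  finally show "(\<integral>\<^sup>+z. norm (g (snd z) * k z) \<partial>(lborel \<Otimes>\<^sub>M lborel)) < \<infinity>" .
qed

lemma AE_lborel_prod_snd:
  assumes "AE t in lborel. P t"
  shows "AE z in (lborel :: ('a::euclidean_space \<times> 'b::euclidean_space) measure). P (snd z)"
proof -
  from assms obtain N where N: "N \<in> null_sets lborel" "{t. \<not> P t} \<subseteq> N"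
    unfolding eventually_ae_filter by auto
  have "UNIV \<times> N \<in> null_sets ((lborel :: 'a measure) \<Otimes>\<^sub>M lborel)"
    using N(1) by (intro lborel.times_in_null_sets2) auto
  then have "UNIV \<times> N \<in> null_sets (lborel :: ('a \<times> 'b) measure)"
    by (simp only: lborel_prod)
  then show ?thesis by (rule AE_I') (use N(2) in auto)
qed

section \<open>Test functions and regular distributions\<close>

lemma iter_partial_append: "iter_partial (bs @ cs) f = iter_partial bs (iter_partial cs f)"
  by (induction bs) auto

lemma mem_supp: "f x \<noteq> 0 \<Longrightarrow> x \<in> supp f"
  using closure_subset[of "{x. f x \<noteq> 0}"] by (auto simp: supp_def)

lemma supp_partial_deriv_subset: "supp (partial_deriv b f) \<subseteq> supp f"
proof -
  have "partial_deriv b f x = 0" if "x \<notin> supp f" for x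
  proof -
    have "\<forall>\<^sub>F y in at x. 0 = f y"
    proof -
      have "\<forall>\<^sub>F y in nhds x. y \<in> - supp f"
        using that by (intro eventually_nhds_in_open) (auto simp: supp_def)
      then show ?thesis unfolding eventually_at_filter
        by (rule eventually_mono) (use mem_supp[of f] in auto)
    qed
    moreover have "f x = 0" using that mem_supp[of f x] by auto
    ultimately have "(f has_derivative (\<lambda>_. 0)) (at x)"
      by (intro has_derivative_transform_eventually[OF has_derivative_const, where g = f]) auto
    then show ?thesis by (simp add: partial_deriv_def frechet_derivative_at[symmetric])
  qed
  then have "{x. partial_deriv b f x \<noteq> 0} \<subseteq> supp f" by blast
  then show ?thesis unfolding supp_def by (rule closure_minimal) simp
qed

text \<open>Closure under differentiation: regularity and support facts about a test function then apply at
  once to the derivatives that occur in the equation.\<close>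

lemma partial_deriv_test_function:
  assumes "\<phi> \<in> test_functions \<Omega>" and b: "b \<in> Basis"
  shows "partial_deriv b \<phi> \<in> test_functions \<Omega>"
proof -
  have "iter_partial bs (partial_deriv b \<phi>) differentiable at x" if "bs \<in> lists Basis" for bs x
  proof -
    have "bs @ [b] \<in> lists Basis" using that b by simp
    then have "iter_partial (bs @ [b]) \<phi> differentiable at x"
      using assms(1) unfolding test_functions_def smooth_def by blast
    then show ?thesis by (simp add: iter_partial_append)
  qed
  moreover have "compact (supp (partial_deriv b \<phi>))"
  proof -
    have "closed (supp (partial_deriv b \<phi>))" by (simp add: supp_def)
    moreover have "supp (partial_deriv b \<phi>) = supp \<phi> \<inter> supp (partial_deriv b \<phi>)"
      using supp_partial_deriv_subset by blast
    ultimately show ?thesis using assms(1) compact_Int_closed unfolding test_functions_def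
      by (metis (mono_tags, lifting) mem_Collect_eq)
  qed
  ultimately show ?thesis
    using assms(1) supp_partial_deriv_subset[of b \<phi>] unfolding test_functions_def smooth_def by auto
qed

lemma test_function_has_derivative:
  assumes "\<phi> \<in> test_functions \<Omega>"
  shows "(\<phi> has_derivative frechet_derivative \<phi> (at x)) (at x)"
proof -
  have "iter_partial [] \<phi> differentiable at x"
    using assms unfolding test_functions_def smooth_def by blast
  then show ?thesis by (simp add: frechet_derivative_works)
qed

lemma test_function_continuous:
  assumes "\<phi> \<in> test_functions \<Omega>"
  shows "continuous_on S \<phi>"
  using test_function_has_derivative[OF assms]
  by (meson continuous_at_imp_continuous_on has_derivative_continuous)

lemma test_function_directional_derivative:
  assumes "\<phi> \<in> test_functions \<Omega>"
  shows "((\<lambda>h. \<phi> (x + h *\<^sub>R b)) has_real_derivative partial_deriv b \<phi> x) (at 0)"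
proof -
  have D: "(\<phi> has_derivative frechet_derivative \<phi> (at x)) (at (x + 0 *\<^sub>R b))"
    using test_function_has_derivative[OF assms] by simp
  have "((\<lambda>h. \<phi> (x + h *\<^sub>R b)) has_derivative (\<lambda>h. frechet_derivative \<phi> (at x) (h *\<^sub>R b))) (at 0)"
    by (rule has_derivative_compose[where f = "\<lambda>h. x + h *\<^sub>R b", OF _ D]) (auto intro!: derivative_eq_intros)
  moreover have "frechet_derivative \<phi> (at x) (h *\<^sub>R b) = partial_deriv b \<phi> x * h" for h
    using linear_frechet_derivative[OF differentiableI[OF test_function_has_derivative[OF assms]], of x]
    by (simp add: partial_deriv_def linear_cmul mult.commute)
  ultimately show ?thesis by (simp add: has_field_derivative_def)
qed

lemma test_function_eq_0_outside: "\<phi> \<in> test_functions \<Omega> \<Longrightarrow> x \<notin> \<Omega> \<Longrightarrow> \<phi> x = 0"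
  using mem_supp[of \<phi> x] unfolding test_functions_def by auto

lemma test_function_vanishes_far:
  assumes "\<phi> \<in> test_functions \<Omega>"
  obtains R where "\<And>x. R < norm x \<Longrightarrow> \<phi> x = 0"
proof -
  have "bounded (supp \<phi>)" using assms compact_imp_bounded unfolding test_functions_def by blast
  then obtain R where R: "\<And>x. x \<in> supp \<phi> \<Longrightarrow> norm x \<le> R" by (auto simp: bounded_iff)
  have "\<phi> x = 0" if "R < norm x" for x
    using R[OF mem_supp[of \<phi> x]] that by force
  then show ?thesis by (rule that)
qed

lemma test_function_bounded:
  assumes "\<phi> \<in> test_functions \<Omega>"
  obtains C where "0 \<le> C" "\<And>x. \<bar>\<phi> x\<bar> \<le> C"
proof -
  have "compact (\<phi> ` supp \<phi>)"
    using assms by (intro compact_continuous_image test_function_continuous[OF assms]) (simp add: test_functions_def)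
  then obtain C where C: "\<forall>x\<in>supp \<phi>. \<bar>\<phi> x\<bar> \<le> C"
    by (auto dest!: compact_imp_bounded simp: bounded_iff)
  have "\<bar>\<phi> x\<bar> \<le> max C 0" for x
    using C mem_supp[of \<phi> x] by (cases "\<phi> x = 0") auto
  then show ?thesis using that[of "max C 0"] by simp
qed

lemma test_function_slice_continuous:
  assumes "\<psi> \<in> test_functions \<Omega>"
  shows "continuous_on S (\<lambda>x. \<psi> (x, t))" and "continuous_on S' (\<lambda>t. \<psi> (x, t))"
  by (rule continuous_on_compose2[OF test_function_continuous[OF assms, of UNIV]];
      auto intro!: continuous_intros)+

lemma test_function_slice_integrable:
  fixes \<psi> :: "'a::euclidean_space \<times> 'b::euclidean_space \<Rightarrow> real"
  assumes \<psi>: "\<psi> \<in> test_functions \<Omega>" and k: "continuous_on UNIV k"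
  shows "integrable lborel (\<lambda>x. \<psi> (x, t) * k x)"
proof -
  obtain R where R: "\<And>z. R < norm z \<Longrightarrow> \<psi> z = 0"
    by (rule test_function_vanishes_far[OF \<psi>]) blast
  have "\<psi> (x, t) = 0" if "R < norm x" for x
    using that norm_fst_le[of x t] by (intro R) simp
  then show ?thesis
    by (intro integrable_continuous_vanishing_far[of _ R] continuous_on_mult
        test_function_slice_continuous(1)[OF \<psi>] k) auto
qed

text \<open>The functional is bounded by the sup norm of the test function times the \<open>L\<^sub>1\<close> norm of \<open>f\<close>, so it has
  order 0 and the same constant serves every compact set.\<close>

lemma regular_distribution:
  assumes \<Omega>: "\<Omega> \<in> sets lebesgue" and f: "set_integrable lebesgue \<Omega> f"
  shows "locally_integrable \<Omega> f" and "distribution \<Omega> (regular_dist \<Omega> f)"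
proof -
  show "locally_integrable \<Omega> f"
    unfolding locally_integrable_def
    by (auto intro!: set_integrable_subset[OF f] dest: compact_imp_closed)
  have int: "set_integrable lebesgue \<Omega> (\<lambda>z. f z * \<phi> z)" if \<phi>: "\<phi> \<in> test_functions \<Omega>" for \<phi>
  proof -
    obtain C where C: "\<And>z. \<bar>\<phi> z\<bar> \<le> C" by (rule test_function_bounded[OF \<phi>]) blast
    have m [measurable]: "\<phi> \<in> borel_measurable lebesgue"
      using test_function_continuous[OF \<phi>, of UNIV]
      by (intro measurable_completion) (simp add: borel_measurable_continuous_onI)
    have [measurable]: "(\<lambda>z. indicat_real \<Omega> z *\<^sub>R f z) \<in> borel_measurable lebesgue"
      using f unfolding set_integrable_def by (rule borel_measurable_integrable)
    have "integrable lebesgue (\<lambda>z. C * (indicat_real \<Omega> z *\<^sub>R f z))"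
      using f unfolding set_integrable_def by (rule integrable_mult_right)
    then have "integrable lebesgue (\<lambda>z. \<phi> z * (indicat_real \<Omega> z *\<^sub>R f z))"
    proof (rule Bochner_Integration.integrable_bound)
      have "\<bar>\<phi> z\<bar> \<le> \<bar>C\<bar>" for z using C[of z] by linarith
      then show "AE z in lebesgue. norm (\<phi> z * (indicat_real \<Omega> z *\<^sub>R f z)) \<le> norm (C * (indicat_real \<Omega> z *\<^sub>R f z))"
        by (auto simp: abs_mult intro!: mult_right_mono)
    qed measurable
    then show ?thesis by (simp add: set_integrable_def mult_ac)
  qed
  have add: "regular_dist \<Omega> f (\<lambda>x. \<phi> x + \<psi> x) = regular_dist \<Omega> f \<phi> + regular_dist \<Omega> f \<psi>"
    if "\<phi> \<in> test_functions \<Omega>" "\<psi> \<in> test_functions \<Omega>" for \<phi> \<psi>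
    using set_integral_add(2)[OF int[OF that(1)] int[OF that(2)]]
    by (simp add: regular_dist_def distrib_left)
  have scale: "regular_dist \<Omega> f (\<lambda>x. c * \<phi> x) = c * regular_dist \<Omega> f \<phi>" for \<phi> c
    using set_integral_mult_right[of lebesgue \<Omega> c "\<lambda>z. f z * \<phi> z"]
    by (simp add: regular_dist_def mult_ac)
  have bound: "\<bar>regular_dist \<Omega> f \<phi>\<bar> \<le> (LINT z:\<Omega>|lebesgue. \<bar>f z\<bar>) * M"
    if \<phi>: "\<phi> \<in> test_functions \<Omega>" and M: "\<And>x. \<bar>\<phi> x\<bar> \<le> M" for \<phi> M
  proof -
    have "\<bar>regular_dist \<Omega> f \<phi>\<bar> \<le> (LINT z:\<Omega>|lebesgue. \<bar>f z * \<phi> z\<bar>)"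
      using set_integral_norm_bound[OF int[OF \<phi>]] by (simp add: regular_dist_def)
    also have "\<dots> \<le> (LINT z:\<Omega>|lebesgue. \<bar>f z\<bar> * M)"
      using M by (intro set_integral_mono set_integrable_abs[OF int[OF \<phi>]] set_integrable_mult_left set_integrable_abs[OF f])
        (auto simp: abs_mult intro: mult_left_mono)
    finally show ?thesis by simp
  qed
  show "distribution \<Omega> (regular_dist \<Omega> f)"
    unfolding distribution_def
  proof (intro conjI ballI allI impI add scale)
    fix K :: "'a set"
    show "\<exists>C N. \<forall>\<phi>\<in>test_functions \<Omega>. supp \<phi> \<subseteq> K \<longrightarrow>
       (\<forall>M. (\<forall>bs\<in>lists Basis. length bs \<le> N \<longrightarrow> (\<forall>x. \<bar>iter_partial bs \<phi> x\<bar> \<le> M))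
          \<longrightarrow> \<bar>regular_dist \<Omega> f \<phi>\<bar> \<le> C * M)"
    proof (intro exI[of _ "LINT z:\<Omega>|lebesgue. \<bar>f z\<bar>"] exI[of _ 0] ballI allI impI)
      fix \<phi> M
      assume "\<phi> \<in> test_functions \<Omega>"
        and "\<forall>bs\<in>lists Basis. length bs \<le> 0 \<longrightarrow> (\<forall>x. \<bar>iter_partial bs \<phi> x\<bar> \<le> M)"
      then show "\<bar>regular_dist \<Omega> f \<phi>\<bar> \<le> (LINT z:\<Omega>|lebesgue. \<bar>f z\<bar>) * M"
        by (intro bound) (auto dest: bspec[of _ _ "[]"])
    qed
  qed
qed

text \<open>Passage from the completed measure, in which distributions are defined, to a Borel representative,
  for which Fubini's theorem is available.\<close>

lemma regular_dist_cong_lborel: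
  fixes f g \<phi> :: "'a::euclidean_space \<Rightarrow> real"
  assumes "integrable lborel (\<lambda>z. \<phi> z * g z)" and "AE z in lborel. indicator \<Omega> z * f z * \<phi> z = \<phi> z * g z"
  shows "regular_dist \<Omega> f \<phi> = (\<integral>z. \<phi> z * g z \<partial>lborel)"
proof -
  have ae: "AE z in lebesgue. \<phi> z * g z = indicator \<Omega> z * f z * \<phi> z"
    using assms(2) by (intro AE_completion) (auto elim: AE_mp)
  have m: "(\<lambda>z. \<phi> z * g z) \<in> borel_measurable lebesgue"
    using assms(1) by (intro measurable_completion) auto
  have "(\<lambda>z. indicator \<Omega> z * f z * \<phi> z) \<in> borel_measurable lebesgue"
    by (rule borel_measurable_AE[OF m ae])
  then have "(\<integral>z. indicator \<Omega> z * f z * \<phi> z \<partial>lebesgue) = (\<integral>z. \<phi> z * g z \<partial>lebesgue)"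
    using ae by (intro integral_cong_AE m) (auto elim: AE_mp)
  also have "\<dots> = (\<integral>z. \<phi> z * g z \<partial>lborel)"
    using assms(1) by (intro integral_completion) auto
  finally show ?thesis by (simp add: regular_dist_def set_lebesgue_integral_def mult.assoc)
qed

section \<open>The heat kernel\<close>

lemma heat_kernel_nonneg: "0 \<le> heat_kernel x s"
  by (simp add: heat_kernel_def heaviside_def)

lemma heat_kernel_eq_0: "s \<le> 0 \<Longrightarrow> heat_kernel x s = 0"
  by (simp add: heat_kernel_def heaviside_def)

lemma heat_kernel_pos_eq:
  "0 < s \<Longrightarrow> heat_kernel (x :: real^'n) s =
     (4 * pi * s) powr (- real CARD('n) / 2) * exp (- (norm x)\<^sup>2 / (4 * s))"
  by (simp add: heat_kernel_def heaviside_def)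

lemma borel_measurable_heaviside [measurable]: "heaviside \<in> borel_measurable borel"
  unfolding heaviside_def by measurable

lemma borel_measurable_heat_kernel [measurable]:
  assumes [measurable]: "f \<in> borel_measurable M" "g \<in> borel_measurable M"
  shows "(\<lambda>z. heat_kernel (f z :: real^'n) (g z)) \<in> borel_measurable M"
  unfolding heat_kernel_def by measurable

text \<open>The kernel at time \<open>s\<close> is the density of \<open>n\<close> independent centred Gaussians of variance \<open>2 s\<close>, which
  gives its total mass.\<close>

lemma heat_kernel_eq_prod_normal_density:
  assumes "0 < s"
  shows "heat_kernel (x :: real^'n) s = (\<Prod>b\<in>Basis. normal_density 0 (sqrt (2 * s)) (x \<bullet> b))"
proof -
  have "(\<Prod>b\<in>(Basis :: (real^'n) set). normal_density 0 (sqrt (2 * s)) (x \<bullet> b)) =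
    (\<Prod>b\<in>(Basis :: (real^'n) set). (4 * pi * s) powr (- (1/2)) * exp (- (x \<bullet> b)\<^sup>2 / (4 * s)))"
    using assms by (intro prod.cong) (auto simp: normal_density_def powr_minus powr_half_sqrt divide_simps ac_simps)
  also have "\<dots> = ((4 * pi * s) powr (- (1/2))) ^ CARD('n) * exp (\<Sum>b\<in>(Basis :: (real^'n) set). - (x \<bullet> b)\<^sup>2 / (4 * s))"
    by (simp add: prod.distrib exp_sum)
  also have "(\<Sum>b\<in>(Basis :: (real^'n) set). - (x \<bullet> b)\<^sup>2 / (4 * s)) = - (norm x)\<^sup>2 / (4 * s)"
  proof -
    have "(norm x)\<^sup>2 = (\<Sum>b\<in>Basis. (x \<bullet> b)\<^sup>2)"
      by (simp add: norm_eq_sqrt_inner euclidean_inner[of x x] power2_eq_square sum_nonneg)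
    then show ?thesis by (simp add: sum_divide_distrib sum_negf)
  qed
  also have "((4 * pi * s) powr (- (1/2))) ^ CARD('n) = (4 * pi * s) powr (- real CARD('n) / 2)"
    using assms by (simp add: powr_realpow[symmetric] powr_powr)
  finally show ?thesis using assms by (simp add: heat_kernel_pos_eq)
qed

lemma nn_integral_heat_kernel:
  assumes "0 < s"
  shows "(\<integral>\<^sup>+x. heat_kernel (x :: real^'n) s \<partial>lborel) = 1"
proof -
  have 1: "(\<integral>\<^sup>+z. normal_density 0 (sqrt (2 * s)) z \<partial>lborel) = 1"
    using assms by (subst nn_integral_eq_integral) auto
  have "(\<integral>\<^sup>+x. heat_kernel (x :: real^'n) s \<partial>lborel) =
    (\<integral>\<^sup>+x. (\<Prod>b\<in>(Basis :: (real^'n) set). ennreal (normal_density 0 (sqrt (2 * s)) (x \<bullet> b))) \<partial>lborel)"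
    using assms by (simp add: heat_kernel_eq_prod_normal_density prod_ennreal)
  also have "\<dots> = (\<Prod>b\<in>(Basis :: (real^'n) set). \<integral>\<^sup>+z. normal_density 0 (sqrt (2 * s)) z \<partial>lborel)"
    by (rule nn_integral_lborel_prod) auto
  finally show ?thesis by (simp add: 1)
qed

lemma has_bochner_integral_heat_kernel:
  assumes "0 < s"
  shows "has_bochner_integral lborel (\<lambda>x :: real^'n. heat_kernel x s) 1"
  by (rule has_bochner_integral_nn_integral) (use assms in \<open>auto simp: nn_integral_heat_kernel heat_kernel_nonneg\<close>)

text \<open>Self-similarity: the substitution \<open>x = \<surd>s y\<close> moves the time into the argument of \<open>f\<close>, where the
  limit \<open>s \<longrightarrow> 0\<close> can be taken pointwise.\<close>

lemma heat_kernel_integral_rescale: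
  fixes f :: "real^'n \<Rightarrow> real"
  assumes s: "0 < s" and [measurable]: "f \<in> borel_measurable borel"
  shows "(\<integral>x. f x * heat_kernel x s \<partial>lborel) = (\<integral>y. f (sqrt s *\<^sub>R y) * heat_kernel y 1 \<partial>lborel)"
proof -
  have scale: "sqrt s ^ CARD('n) * heat_kernel (sqrt s *\<^sub>R y) s = heat_kernel y 1" for y :: "real^'n"
  proof -
    have "sqrt s ^ CARD('n) = s powr (real CARD('n) / 2)"
      using s by (simp add: powr_realpow[symmetric] powr_half_sqrt[symmetric] powr_powr)
    moreover have "(4 * pi * s) powr (- real CARD('n) / 2) = (4 * pi) powr (- real CARD('n) / 2) * s powr (- real CARD('n) / 2)"
      using s by (simp add: powr_mult)
    ultimately show ?thesis
      using s by (simp add: heat_kernel_pos_eq power_mult_distrib powr_minus field_simps)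
  qed
  have "(\<integral>x. f x * heat_kernel x s \<partial>lborel) =
    (\<integral>x. f x * heat_kernel x s \<partial>density (distr lborel borel (\<lambda>x :: real^'n. 0 + sqrt s *\<^sub>R x)) (\<lambda>_. \<bar>sqrt s\<bar> ^ DIM(real^'n)))"
    using s by (subst lborel_affine[of "sqrt s" 0]) auto
  also have "\<dots> = (\<integral>x. sqrt s ^ CARD('n) *\<^sub>R (f x * heat_kernel x s) \<partial>distr lborel borel (\<lambda>x :: real^'n. 0 + sqrt s *\<^sub>R x))"
    using s by (subst integral_density[symmetric]) (auto simp: ennreal_power)
  also have "\<dots> = (\<integral>x. sqrt s ^ CARD('n) *\<^sub>R (f (0 + sqrt s *\<^sub>R x) * heat_kernel (0 + sqrt s *\<^sub>R x) s) \<partial>lborel)"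
    by (subst integral_distr) auto
  finally show ?thesis by (simp add: scale[symmetric] mult_ac)
qed

lemma heat_kernel_x_derivative:
  assumes "0 < s"
  shows "((\<lambda>h. heat_kernel ((x :: real^'n) + h *\<^sub>R axis i 1) s) has_real_derivative
           - (x $ i / (2 * s)) * heat_kernel x s) (at 0)"
proof -
  have n: "(norm (x + h *\<^sub>R axis i 1))\<^sup>2 = (norm x)\<^sup>2 + 2 * h * x $ i + h\<^sup>2" for h
    unfolding power2_norm_eq_inner
    by (simp add: inner_add inner_axis inner_axis' power2_eq_square algebra_simps del: dot_square_norm)
  show ?thesis
    unfolding heat_kernel_pos_eq[OF assms] n
    using assms by (auto intro!: derivative_eq_intros simp: field_simps)
qed

lemma heat_kernel_xx_derivative:
  assumes "0 < s"
  shows "((\<lambda>h. - ((x + h *\<^sub>R axis i 1) $ i / (2 * s)) * heat_kernel ((x :: real^'n) + h *\<^sub>R axis i 1) s)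
           has_real_derivative ((x $ i)\<^sup>2 / (4 * s\<^sup>2) - 1 / (2 * s)) * heat_kernel x s) (at 0)"
proof -
  have "((\<lambda>h. - ((x $ i + h) / (2 * s)) * heat_kernel (x + h *\<^sub>R axis i 1) s)
     has_real_derivative ((x $ i)\<^sup>2 / (4 * s\<^sup>2) - 1 / (2 * s)) * heat_kernel x s) (at 0)"
    using assms by (auto intro!: derivative_eq_intros heat_kernel_x_derivative simp: power2_eq_square field_simps)
  then show ?thesis by simp
qed

text \<open>The common value of \<open>\<partial>\<^sub>s\<close> and \<open>\<Delta>\<^sub>x\<close> of the heat kernel at times \<open>s > 0\<close>; see
  \<open>heat_kernel_s_derivative\<close> and \<open>heat_kernel_dt_eq_laplacian\<close>.\<close>

definition heat_kernel_dt :: "real^'n \<Rightarrow> real \<Rightarrow> real" where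
  "heat_kernel_dt x s = ((norm x)\<^sup>2 / (4 * s\<^sup>2) - real CARD('n) / (2 * s)) * heat_kernel x s"

text \<open>The summands are the second derivatives of \<open>heat_kernel_xx_derivative\<close>, so this is the heat
  equation for the kernel.\<close>

lemma heat_kernel_dt_eq_laplacian:
  "heat_kernel_dt (x :: real^'n) s = (\<Sum>i\<in>UNIV. ((x $ i)\<^sup>2 / (4 * s\<^sup>2) - 1 / (2 * s)) * heat_kernel x s)"
proof -
  have "(norm x)\<^sup>2 = (\<Sum>i\<in>UNIV. (x $ i)\<^sup>2)"
    by (simp add: norm_vec_def L2_set_def sum_nonneg)
  then show ?thesis
    by (simp add: heat_kernel_dt_def sum_distrib_right[symmetric] sum_subtractf sum_divide_distrib)
qed

lemma heat_kernel_s_derivative: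
  assumes "0 < s"
  shows "((\<lambda>s. heat_kernel (x :: real^'n) s) has_real_derivative heat_kernel_dt x s) (at s)"
proof -
  let ?n = "real CARD('n)"
  have "((\<lambda>s. (4 * pi * s) powr (- ?n / 2) * exp (- (norm x)\<^sup>2 / (4 * s))) has_real_derivative heat_kernel_dt x s) (at s)"
  proof -
    have "(4 * pi * s) powr (- ?n / 2 - 1) = (4 * pi * s) powr (- ?n / 2) / (4 * pi * s)"
      using assms by (simp add: powr_diff)
    then show ?thesis
      using assms unfolding heat_kernel_dt_def heat_kernel_pos_eq[OF assms]
      by (auto intro!: derivative_eq_intros simp: power2_eq_square field_simps)
  qed
  moreover have "\<forall>\<^sub>F r in nhds s. heat_kernel x r = (4 * pi * r) powr (- ?n / 2) * exp (- (norm x)\<^sup>2 / (4 * r))"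
    using eventually_nhds_in_open[of "{0<..}" s] assms
    by (auto elim!: eventually_mono simp: heat_kernel_pos_eq)
  ultimately show ?thesis by (subst DERIV_cong_ev[OF refl _ refl]) auto
qed

lemma continuous_on_heat_kernel [continuous_intros]:
  fixes f :: "'z::topological_space \<Rightarrow> real^'n"
  assumes "continuous_on S f" "continuous_on S g" "\<And>z. z \<in> S \<Longrightarrow> 0 < g z"
  shows "continuous_on S (\<lambda>z. heat_kernel (f z) (g z))"
proof -
  have "continuous_on S (\<lambda>z. (4 * pi * g z) powr (- real CARD('n) / 2) * exp (- (norm (f z))\<^sup>2 / (4 * g z)))"
    using assms by (force intro!: continuous_intros)
  then show ?thesis using assms(3) by (subst continuous_on_cong[OF refl heat_kernel_pos_eq]) auto
qed

lemma continuous_on_heat_kernel_dt [continuous_intros]: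
  fixes f :: "'z::topological_space \<Rightarrow> real^'n"
  assumes "continuous_on S f" "continuous_on S g" "\<And>z. z \<in> S \<Longrightarrow> 0 < g z"
  shows "continuous_on S (\<lambda>z. heat_kernel_dt (f z) (g z))"
  unfolding heat_kernel_dt_def using assms by (force intro!: continuous_intros)

lemma borel_measurable_heat_kernel_dt [measurable]:
  assumes [measurable]: "f \<in> borel_measurable M" "g \<in> borel_measurable M"
  shows "(\<lambda>z. heat_kernel_dt (f z :: real^'n) (g z)) \<in> borel_measurable M"
  unfolding heat_kernel_dt_def by measurable

lemma heat_kernel_coeff_formula:
  fixes x :: "real^'n"
  assumes pos: "\<And>t. 0 < t \<Longrightarrow> t \<le> T \<Longrightarrow> 0 < primitive0 a t" and "t < T"
  shows "heat_kernel_coeff a x t = heaviside t * exp (- (norm x)\<^sup>2 / (4 * primitive0 a t)) /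
              (4 * pi * primitive0 a t) powr (real CARD('n) / 2)"
proof (cases "0 < t")
  case True
  then have "0 < primitive0 a t" using assms by simp
  then show ?thesis using True
    by (simp add: heat_kernel_coeff_def heat_kernel_pos_eq heaviside_def powr_minus divide_simps)
next
  case False
  have "primitive0 a t = 0"
  proof (cases "t = 0")
    case True
    have "(\<lambda>x. indicat_real {0} x *\<^sub>R a x) = (\<lambda>x. indicat_real {0} x *\<^sub>R a 0)" by (auto simp: indicator_def)
    then show ?thesis using True by (simp add: primitive0_def set_lebesgue_integral_def)
  qed (use False in \<open>simp add: primitive0_def set_lebesgue_integral_def\<close>)
  with False show ?thesis by (simp add: heat_kernel_coeff_def heat_kernel_eq_0 heaviside_def)
qed

section \<open>The heat kernel tested against a test function\<close>

definition x_laplacian :: "((real^'n) \<times> real \<Rightarrow> real) \<Rightarrow> (real^'n) \<times> real \<Rightarrow> real" where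
  "x_laplacian \<phi> z = (\<Sum>i\<in>UNIV. partial_deriv (axis i 1, 0) (partial_deriv (axis i 1, 0) \<phi>) z)"

lemma x_direction_in_Basis: "((axis i 1 :: real^'n), 0 :: real) \<in> Basis"
  by (simp add: Basis_prod_def axis_in_Basis_iff)

lemma t_direction_in_Basis: "(0 :: real^'n, 1 :: real) \<in> Basis"
  by (simp add: Basis_prod_def)

text \<open>Green's second identity for \<open>\<phi>(\<cdot>, t)\<close> and the kernel: for each direction \<open>i\<close> the difference of the
  two integrands is the \<open>i\<close>-th derivative of \<open>\<phi> \<partial>\<^sub>i\<epsilon>\<^sub>n - \<epsilon>\<^sub>n \<partial>\<^sub>i\<phi>\<close>, which is compactly supported in \<open>x\<close>.\<close>

lemma heat_kernel_transfer_laplacian: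
  fixes \<phi> :: "(real^'n) \<times> real \<Rightarrow> real"
  assumes \<phi>: "\<phi> \<in> test_functions \<Omega>" and s: "0 < s"
  shows "(\<integral>x. \<phi> (x, t) * heat_kernel_dt x s \<partial>lborel) = (\<integral>x. x_laplacian \<phi> (x, t) * heat_kernel x s \<partial>lborel)"
proof -
  let ?e = "\<lambda>i. ((axis i 1 :: real^'n), 0 :: real)"
  let ?c = "\<lambda>x i. (x $ i)\<^sup>2 / (4 * s\<^sup>2) - 1 / (2 * s)"
  have d1: "partial_deriv (?e i) \<phi> \<in> test_functions \<Omega>" for i
    by (rule partial_deriv_test_function[OF \<phi> x_direction_in_Basis])
  have d2: "partial_deriv (?e i) (partial_deriv (?e i) \<phi>) \<in> test_functions \<Omega>" for i
    by (rule partial_deriv_test_function[OF d1 x_direction_in_Basis])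
  have hk: "continuous_on UNIV (\<lambda>x :: real^'n. heat_kernel x s)"
    using s by (intro continuous_intros) auto
  have i1: "integrable lborel (\<lambda>x. \<phi> (x, t) * (?c x i * heat_kernel x s))" for i
    using s by (intro test_function_slice_integrable[OF \<phi>] continuous_intros) auto
  have i2: "integrable lborel (\<lambda>x. partial_deriv (?e i) (partial_deriv (?e i) \<phi>) (x, t) * heat_kernel x s)" for i
    by (intro test_function_slice_integrable[OF d2] hk)
  have by_parts: "(\<integral>x. \<phi> (x, t) * (?c x i * heat_kernel x s) \<partial>lborel) =
     (\<integral>x. partial_deriv (?e i) (partial_deriv (?e i) \<phi>) (x, t) * heat_kernel x s \<partial>lborel)" for i
  proof -
    obtain R where R: "\<And>z. R < norm z \<Longrightarrow> \<phi> z = 0" by (rule test_function_vanishes_far[OF \<phi>]) blast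
    obtain R1 where R1: "\<And>z. R1 < norm z \<Longrightarrow> partial_deriv (?e i) \<phi> z = 0"
      by (rule test_function_vanishes_far[OF d1]) blast
    obtain R2 where R2: "\<And>z. R2 < norm z \<Longrightarrow> partial_deriv (?e i) (partial_deriv (?e i) \<phi>) z = 0"
      by (rule test_function_vanishes_far[OF d2]) blast
    have dir: "((\<lambda>h. \<psi> (x + h *\<^sub>R axis i 1, t)) has_real_derivative partial_deriv (?e i) \<psi> (x, t)) (at 0)"
      if "\<psi> \<in> test_functions \<Omega>" for \<psi> x
      using test_function_directional_derivative[OF that, of "(x, t)" "?e i"] by simp
    \<comment> \<open>The first-order terms \<open>\<partial>\<^sub>i\<phi> \<partial>\<^sub>i\<epsilon>\<^sub>n\<close> cancel in the derivative of \<open>?f\<close>.\<close>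
    let ?f = "\<lambda>x. \<phi> (x, t) * (- (x $ i / (2 * s)) * heat_kernel x s) - partial_deriv (?e i) \<phi> (x, t) * heat_kernel x s"
    let ?f' = "\<lambda>x. \<phi> (x, t) * (?c x i * heat_kernel x s)
        - partial_deriv (?e i) (partial_deriv (?e i) \<phi>) (x, t) * heat_kernel x s"
    have "(\<integral>x. ?f' x \<partial>lborel) = 0"
    proof (rule integral_directional_derivative_eq_0[where f = ?f and e = "axis i 1" and R = "max R (max R1 R2)"])
      show "((\<lambda>h. ?f (x + h *\<^sub>R axis i 1)) has_real_derivative ?f' x) (at 0)" for x
        using DERIV_diff[OF DERIV_mult[OF dir[OF \<phi>] heat_kernel_xx_derivative[OF s, where x = x and i = i]]
            DERIV_mult[OF dir[OF d1] heat_kernel_x_derivative[OF s, where x = x and i = i]]]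
        by (rule DERIV_cong) (simp add: algebra_simps)
      show "continuous_on UNIV ?f" "continuous_on UNIV ?f'"
        using s by (intro continuous_intros test_function_slice_continuous(1)[OF \<phi>]
            test_function_slice_continuous(1)[OF d1] test_function_slice_continuous(1)[OF d2] hk; simp)+
      show "?f x = 0" "?f' x = 0" if "max R (max R1 R2) < norm x" for x
      proof -
        have "max R (max R1 R2) < norm (x, t)" using that norm_fst_le[of x t] by linarith
        then have "\<phi> (x, t) = 0" "partial_deriv (?e i) \<phi> (x, t) = 0"
          "partial_deriv (?e i) (partial_deriv (?e i) \<phi>) (x, t) = 0"
          by (intro R R1 R2; simp)+
        then show "?f x = 0" "?f' x = 0" by simp_all
      qed
    qed
    then show ?thesis using i1 i2 by (subst (asm) Bochner_Integration.integral_diff) auto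
  qed
  have "(\<integral>x. \<phi> (x, t) * heat_kernel_dt x s \<partial>lborel) = (\<Sum>i\<in>UNIV. \<integral>x. \<phi> (x, t) * (?c x i * heat_kernel x s) \<partial>lborel)"
    by (subst Bochner_Integration.integral_sum[symmetric, OF i1]) (simp add: heat_kernel_dt_eq_laplacian sum_distrib_left)
  also have "\<dots> = (\<integral>x. x_laplacian \<phi> (x, t) * heat_kernel x s \<partial>lborel)"
    unfolding by_parts x_laplacian_def sum_distrib_right
    by (rule Bochner_Integration.integral_sum[symmetric, OF i2])
  finally show ?thesis .
qed

text \<open>After rescaling, the Gaussian of time 1 is fixed and the argument of \<open>\<phi>\<close> tends to \<open>(0, t0)\<close>.\<close>

lemma heat_kernel_approximate_identity:
  fixes \<phi> :: "(real^'n) \<times> real \<Rightarrow> real"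
  assumes \<phi>: "\<phi> \<in> test_functions \<Omega>"
    and s: "\<And>m. 0 < s m" "s \<longlonglongrightarrow> 0" and t: "t \<longlonglongrightarrow> t0"
  shows "(\<lambda>m. \<integral>x. \<phi> (x, t m) * heat_kernel x (s m) \<partial>lborel) \<longlonglongrightarrow> \<phi> (0, t0)"
proof -
  have cont: "continuous_on UNIV \<phi>" by (rule test_function_continuous[OF \<phi>])
  have [measurable]: "(\<lambda>x. \<phi> (x, r)) \<in> borel_measurable borel" for r
    by (intro borel_measurable_continuous_onI continuous_on_compose2[OF cont]) (auto intro!: continuous_intros)
  obtain C where C: "0 \<le> C" "\<And>z. \<bar>\<phi> z\<bar> \<le> C" by (rule test_function_bounded[OF \<phi>]) blast
  note hk = has_bochner_integral_heat_kernel[where 'n = 'n, of 1, simplified]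
  have "(\<lambda>m. \<integral>y. \<phi> (sqrt (s m) *\<^sub>R y, t m) * heat_kernel y 1 \<partial>lborel) \<longlonglongrightarrow> (\<integral>y. \<phi> (0, t0) * heat_kernel (y :: real^'n) 1 \<partial>lborel)"
  proof (rule integral_dominated_convergence)
    show "integrable lborel (\<lambda>y :: real^'n. C * heat_kernel y 1)"
      using hk by (simp add: has_bochner_integral_iff)
    show "AE y :: real^'n in lborel. (\<lambda>m. \<phi> (sqrt (s m) *\<^sub>R y, t m) * heat_kernel y 1) \<longlonglongrightarrow> \<phi> (0, t0) * heat_kernel y 1"
    proof (rule AE_I2)
      fix y :: "real^'n"
      have "(\<lambda>m. sqrt (s m)) \<longlonglongrightarrow> sqrt 0" by (rule tendsto_real_sqrt[OF s(2)])
      then have "(\<lambda>m. (sqrt (s m) *\<^sub>R y, t m)) \<longlonglongrightarrow> (sqrt 0 *\<^sub>R y, t0)"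
        by (intro tendsto_Pair tendsto_scaleR tendsto_const t)
      then have "(\<lambda>m. \<phi> (sqrt (s m) *\<^sub>R y, t m)) \<longlonglongrightarrow> \<phi> (sqrt 0 *\<^sub>R y, t0)"
        by (rule continuous_on_tendsto_compose[OF cont]) auto
      then show "(\<lambda>m. \<phi> (sqrt (s m) *\<^sub>R y, t m) * heat_kernel y 1) \<longlonglongrightarrow> \<phi> (0, t0) * heat_kernel y 1"
        by (intro tendsto_intros) simp
    qed
    show "AE y :: real^'n in lborel. norm (\<phi> (sqrt (s m) *\<^sub>R y, t m) * heat_kernel y 1) \<le> C * heat_kernel y 1" for m
      using C by (auto simp: abs_mult heat_kernel_nonneg intro!: mult_right_mono)
  qed measurable
  moreover have "(\<integral>y. \<phi> (0, t0) * heat_kernel (y :: real^'n) 1 \<partial>lborel) = \<phi> (0, t0)"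
    using hk by (simp add: has_bochner_integral_iff)
  moreover have "(\<integral>x. \<phi> (x, t m) * heat_kernel x (s m) \<partial>lborel) =
      (\<integral>y. \<phi> (sqrt (s m) *\<^sub>R y, t m) * heat_kernel y 1 \<partial>lborel)" for m
    by (rule heat_kernel_integral_rescale) (auto simp: s)
  ultimately show ?thesis by (simp only:)
qed

section \<open>The weak equation in the new time scale\<close>

text \<open>The coefficient is here a Borel function that is integrable on the whole line, and \<open>A\<close> is an
  arbitrary Borel function that is its primitive on \<open>[0, T]\<close>; this keeps completed measures out of the
  applications of Fubini's theorem.\<close>

locale positive_primitive =
  fixes T :: real and a A :: "real \<Rightarrow> real"
  assumes T_pos: "0 < T"
    and a_integrable: "integrable lborel a"
    and A_measurable [measurable]: "A \<in> borel_measurable borel"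
    and A_0: "A 0 = 0"
    and A_pos: "\<And>t. 0 < t \<Longrightarrow> t \<le> T \<Longrightarrow> 0 < A t"
    and A_diff: "\<And>s t. 0 \<le> s \<Longrightarrow> s \<le> t \<Longrightarrow> t \<le> T \<Longrightarrow> A t - A s = integral {s..t} a"
begin

text \<open>The time \<open>T\<close> is included so that no boundary case arises in the slabs \<open>\<eta> \<le> t \<le> T\<close> below; on the open
  domain \<open>t < T\<close> this is the claimed fundamental solution.\<close>

definition kernel :: "(real^'n) \<times> real \<Rightarrow> real" where
  "kernel z = indicator {0<..T} (snd z) * heat_kernel (fst z) (A (snd z))"

lemma a_measurable [measurable]: "a \<in> borel_measurable borel"
  using a_integrable by auto

lemma a_absolutely_integrable: "a absolutely_integrable_on {u..v}"
proof -
  have "integrable lebesgue a" using a_integrable by (simp add: integrable_completion)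
  then show ?thesis unfolding set_integrable_def
    by (intro integrable_mult_indicator) auto
qed

lemma A_continuous: "continuous_on {0..T} A"
proof -
  have "continuous_on {0..T} (\<lambda>t. integral {0..t} a)"
    by (rule indefinite_integral_continuous_1)
      (use a_absolutely_integrable in \<open>simp add: absolutely_integrable_on_def\<close>)
  moreover have "integral {0..t} a = A t" if "t \<in> {0..T}" for t
    using A_diff[of 0 t] A_0 that by simp
  ultimately show ?thesis by (subst continuous_on_cong[of _ _ _ "\<lambda>t. integral {0..t} a"]) auto
qed

lemma kernel_measurable [measurable]:
  "(kernel :: (real^'n) \<times> real \<Rightarrow> real) \<in> borel_measurable (lborel \<Otimes>\<^sub>M lborel)"
  unfolding kernel_def[abs_def] by measurable

lemma kernel_mass: "(\<integral>\<^sup>+x. norm (kernel (x :: real^'n, t)) \<partial>lborel) \<le> ennreal 1"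
proof (cases "0 < t \<and> t \<le> T")
  case True
  then show ?thesis
    using nn_integral_heat_kernel[OF A_pos, of t, where 'n = 'n]
    by (simp add: kernel_def heat_kernel_nonneg)
qed (auto simp: kernel_def)

lemma integrable_times_kernel:
  assumes "integrable lborel g"
  shows "integrable (lborel \<Otimes>\<^sub>M lborel) (\<lambda>z :: (real^'n) \<times> real. g (snd z) * kernel z)"
  by (rule integrable_kernel_times_snd[OF kernel_measurable assms kernel_mass])

lemma integrable_kernel: "integrable (lborel \<Otimes>\<^sub>M lborel) (kernel :: (real^'n) \<times> real \<Rightarrow> real)"
proof -
  have "integrable lborel (indicator {0<..T} :: real \<Rightarrow> real)"
    by (rule integrable_real_indicator) (use T_pos in auto)
  from integrable_times_kernel[OF this, where 'n = 'n] show ?thesis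
    by (simp add: kernel_def[abs_def] mult.assoc[symmetric] flip: indicator_inter_arith)
qed

context
  fixes \<phi> :: "(real^'n) \<times> real \<Rightarrow> real"
  assumes \<phi>: "\<phi> \<in> test_functions (UNIV \<times> {..<T})"
begin

abbreviation "dt \<equiv> partial_deriv (0 :: real^'n, 1 :: real) \<phi>"

lemma dt_test_function: "dt \<in> test_functions (UNIV \<times> {..<T})"
  by (rule partial_deriv_test_function[OF \<phi> t_direction_in_Basis])

lemma xx_test_function:
  "partial_deriv (axis i 1, 0) (partial_deriv (axis i 1, 0) \<phi>) \<in> test_functions (UNIV \<times> {..<T})"
  by (intro partial_deriv_test_function \<phi> x_direction_in_Basis)

lemma x_laplacian_continuous: "continuous_on S (x_laplacian \<phi>)"
  unfolding x_laplacian_def[abs_def]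
  by (intro continuous_intros test_function_continuous[OF xx_test_function])

lemma x_laplacian_bounded: obtains C where "0 \<le> C" "\<And>z. \<bar>x_laplacian \<phi> z\<bar> \<le> C"
proof -
  have "\<exists>C. \<forall>z. \<bar>partial_deriv (axis i 1, 0) (partial_deriv (axis i 1, 0) \<phi>) z\<bar> \<le> C" for i
    using test_function_bounded[OF xx_test_function] by metis
  then obtain C where C: "\<And>i z. \<bar>partial_deriv (axis i 1, 0) (partial_deriv (axis i 1, 0) \<phi>) z\<bar> \<le> C i"
    by metis
  have b: "\<bar>x_laplacian \<phi> z\<bar> \<le> sum C UNIV" for z
    unfolding x_laplacian_def by (rule order_trans[OF sum_abs sum_mono]) (rule C)
  then show ?thesis using that[OF _ b] abs_ge_zero order_trans by blast
qed

lemma measurable_coefficients [measurable]: "\<phi> \<in> borel_measurable (lborel \<Otimes>\<^sub>M lborel)"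
  "dt \<in> borel_measurable (lborel \<Otimes>\<^sub>M lborel)"
  "x_laplacian \<phi> \<in> borel_measurable (lborel \<Otimes>\<^sub>M lborel)"
  by (intro measurable_pair_continuous test_function_continuous[OF \<phi>]
      test_function_continuous[OF dt_test_function] x_laplacian_continuous)+

lemma integrable_dt: "integrable (lborel \<Otimes>\<^sub>M lborel) (\<lambda>z. dt z * kernel z)"
proof -
  obtain C where "\<And>z. \<bar>dt z\<bar> \<le> C" by (rule test_function_bounded[OF dt_test_function]) blast
  then show ?thesis by (intro integrable_bounded_mult integrable_kernel) auto
qed

lemma integrable_laplacian:
  "integrable (lborel \<Otimes>\<^sub>M lborel) (\<lambda>z. x_laplacian \<phi> z * (a (snd z) * kernel z))"
proof -
  obtain C where "\<And>z. \<bar>x_laplacian \<phi> z\<bar> \<le> C" by (rule x_laplacian_bounded) blast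
  then show ?thesis
    by (intro integrable_bounded_mult integrable_times_kernel[OF a_integrable]) auto
qed

definition weak_integrand :: "(real^'n) \<times> real \<Rightarrow> real" where
  "weak_integrand z = dt z * kernel z + x_laplacian \<phi> z * (a (snd z) * kernel z)"

lemma integrable_weak_integrand: "integrable (lborel \<Otimes>\<^sub>M lborel) weak_integrand"
  unfolding weak_integrand_def[abs_def] using integrable_dt integrable_laplacian by simp

text \<open>The chain rule for \<open>k(t, s) = \<phi>(x, t) \<epsilon>\<^sub>n(x, s)\<close> along \<open>s = A(t)\<close>. Keeping away from \<open>t = 0\<close> ensures
  \<open>s > 0\<close>, where the kernel is smooth; at \<open>t = T\<close> the test function vanishes.\<close>

lemma slice_time_integral:
  assumes \<eta>: "0 < \<eta>" "\<eta> \<le> T"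
  shows "integral {\<eta>..T} (\<lambda>t. dt (x, t) * heat_kernel x (A t) + a t * (\<phi> (x, t) * heat_kernel_dt x (A t)))
    = - (\<phi> (x, \<eta>) * heat_kernel x (A \<eta>))"
proof -
  let ?k = "\<lambda>p. \<phi> (x, fst p) * heat_kernel x (snd p)"
  have A: "continuous_on {\<eta>..T} A" by (rule continuous_on_subset[OF A_continuous]) (use \<eta> in auto)
  have "integral {\<eta>..T} (\<lambda>t. dt (x, t) * heat_kernel x (A t) + a t * (\<phi> (x, t) * heat_kernel_dt x (A t)))
     = ?k (T, A T) - ?k (\<eta>, A \<eta>)"
  proof (rule chain_rule_along_primitive[OF \<eta>(2) a_absolutely_integrable])
    show "A t - A s = integral {s..t} a" if "\<eta> \<le> s" "s \<le> t" "t \<le> T" for s t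
      using that \<eta> by (intro A_diff) auto
    show "(?k has_derivative (\<lambda>h. dt (x, t) * heat_kernel x (A t) * fst h + \<phi> (x, t) * heat_kernel_dt x (A t) * snd h)) (at (t, A t))"
      if "\<eta> \<le> t" "t \<le> T" for t
    proof -
      have "((\<lambda>h. \<phi> (x, t + h)) has_real_derivative dt (x, t)) (at 0)"
        using test_function_directional_derivative[OF \<phi>, of "(x, t)" "(0, 1)"] by simp
      then have "((\<lambda>r. \<phi> (x, r)) has_real_derivative dt (x, t)) (at t)"
        using DERIV_shift[of "\<lambda>r. \<phi> (x, r)" "dt (x, t)" 0 t] by (simp add: add.commute)
      then have D1: "((\<lambda>r. \<phi> (x, r)) has_derivative (\<lambda>h. dt (x, t) * h)) (at (fst (t, A t)))"
        by (simp add: has_field_derivative_def)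
      have D2: "((\<lambda>s. heat_kernel x s) has_derivative (\<lambda>h. heat_kernel_dt x (A t) * h)) (at (snd (t, A t)))"
        using heat_kernel_s_derivative[OF A_pos, of t x] that \<eta> by (simp add: has_field_derivative_def)
      have "((\<lambda>p. \<phi> (x, fst p)) has_derivative (\<lambda>h. dt (x, t) * fst h)) (at (t, A t))"
        by (rule has_derivative_compose[where f = fst, OF _ D1]) (rule has_derivative_fst[OF has_derivative_ident])
      moreover have "((\<lambda>p. heat_kernel x (snd p)) has_derivative (\<lambda>h. heat_kernel_dt x (A t) * snd h)) (at (t, A t))"
        by (rule has_derivative_compose[where f = snd, OF _ D2]) (rule has_derivative_snd[OF has_derivative_ident])
      ultimately show ?thesis
        by (rule has_derivative_eq_rhs[OF has_derivative_mult]) (auto simp: fun_eq_iff algebra_simps)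
    qed
    show "continuous_on {\<eta>..T} (\<lambda>t. dt (x, t) * heat_kernel x (A t))"
      "continuous_on {\<eta>..T} (\<lambda>t. \<phi> (x, t) * heat_kernel_dt x (A t))"
      using A_pos \<eta> by (intro continuous_intros A
          test_function_slice_continuous(2)[OF \<phi>] test_function_slice_continuous(2)[OF dt_test_function]; simp)+
  qed
  moreover have "\<phi> (x, T) = 0" by (rule test_function_eq_0_outside[OF \<phi>]) simp
  ultimately show ?thesis by simp
qed

text \<open>On a slab \<open>\<eta> \<le> t \<le> T\<close> the time \<open>A(t)\<close> is bounded away from 0, so that \<open>\<phi> \<partial>\<^sub>s\<epsilon>\<^sub>n\<close> is bounded with
  compact support and may be multiplied by \<open>a\<close>. As \<open>t \<longrightarrow> 0\<close> this bound is lost, which is why the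
  derivatives are moved to \<open>\<phi>\<close> before the limit is taken.\<close>

lemma integrable_slab_t_form:
  assumes \<eta>: "0 < \<eta>" "\<eta> \<le> T"
  shows "integrable (lborel \<Otimes>\<^sub>M lborel) (\<lambda>z. indicator {\<eta>..T} (snd z) *
    (dt z * heat_kernel (fst z) (A (snd z)) + a (snd z) * (\<phi> z * heat_kernel_dt (fst z) (A (snd z)))))"
proof -
  obtain R where R: "\<And>z. R < norm z \<Longrightarrow> \<phi> z = 0" by (rule test_function_vanishes_far[OF \<phi>]) blast
  define K where "K = cball (0 :: real^'n) R \<times> {\<eta>..T}"
  define h where "h z = \<phi> z * heat_kernel_dt (fst z) (A (snd z))" for z
  have "continuous_on {\<eta>..T} A" by (rule continuous_on_subset[OF A_continuous]) (use \<eta> in auto)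
  then have "continuous_on K (\<lambda>z. A (snd z))"
    by (rule continuous_on_compose2) (auto simp: K_def intro!: continuous_intros)
  then have "continuous_on K h"
    unfolding h_def using \<eta> A_pos
    by (intro continuous_intros test_function_continuous[OF \<phi>]) (auto simp: K_def)
  moreover have "compact K" unfolding K_def by (intro compact_Times) auto
  ultimately have "bounded (h ` K)" by (intro compact_imp_bounded compact_continuous_image)
  then obtain C where C: "\<forall>z\<in>K. \<bar>h z\<bar> \<le> C" by (auto simp: bounded_iff)
  have kx: "norm (indicator {\<eta>..T} t * h (x, t)) \<le> \<bar>C\<bar> * indicator (cball 0 R) x" for x t
  proof (cases "t \<in> {\<eta>..T} \<and> norm x \<le> R")
    case True
    then show ?thesis using C[rule_format, of "(x, t)"] by (auto simp: K_def indicator_def)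
  next
    case False
    have "h (x, t) = 0" if "R < norm x"
      using R[of "(x, t)"] that norm_fst_le[of x t] by (simp add: h_def)
    with False show ?thesis by (auto simp: indicator_def)
  qed
  have [measurable]: "h \<in> borel_measurable (lborel \<Otimes>\<^sub>M lborel)" unfolding h_def by measurable
  have ball: "integrable lborel (\<lambda>x :: real^'n. \<bar>C\<bar> * indicator (cball 0 R) x)"
    using borel_integrable_compact[of "cball (0 :: real^'n) R" "\<lambda>_. \<bar>C\<bar>"] by (simp add: mult.commute)
  have "integrable (lborel \<Otimes>\<^sub>M lborel) (\<lambda>z. a (snd z) * (indicator {\<eta>..T} (snd z) * h z))"
  proof (rule integrable_kernel_times_snd[OF _ a_integrable])
    show "(\<integral>\<^sup>+x. norm (indicator {\<eta>..T} (snd (x, t)) * h (x, t)) \<partial>lborel)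
        \<le> ennreal (\<integral>x. \<bar>C\<bar> * indicator (cball (0 :: real^'n) R) x \<partial>lborel)" for t
      using kx by (subst nn_integral_eq_integral[OF ball, symmetric])
        (auto intro!: nn_integral_mono ennreal_leI)
  qed measurable
  moreover have "integrable (lborel \<Otimes>\<^sub>M lborel) (\<lambda>z. indicator {\<eta>..T} (snd z) * (dt z * kernel z))"
    by (rule integrable_bounded_mult[OF integrable_dt, where C = 1]) (auto simp: indicator_def)
  ultimately have "integrable (lborel \<Otimes>\<^sub>M lborel) (\<lambda>z. indicator {\<eta>..T} (snd z) * (dt z * kernel z)
      + a (snd z) * (indicator {\<eta>..T} (snd z) * h z))" by (rule Bochner_Integration.integrable_add[rotated])
  then show ?thesis
    by (rule Bochner_Integration.integrable_cong[OF refl, THEN iffD1, rotated])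
      (use \<eta> in \<open>auto simp: h_def kernel_def indicator_def\<close>)
qed

text \<open>Fubini's theorem in both directions: integrating first in \<open>x\<close> replaces \<open>\<phi> \<Delta>\<epsilon>\<^sub>n\<close> by \<open>\<epsilon>\<^sub>n \<Delta>\<phi>\<close>, integrating
  first in \<open>t\<close> leaves only the boundary term.\<close>

lemma weak_integral_slab:
  assumes \<eta>: "0 < \<eta>" "\<eta> \<le> T"
  shows "(\<integral>z. indicator {\<eta>..T} (snd z) * weak_integrand z \<partial>(lborel \<Otimes>\<^sub>M lborel)) =
    - (\<integral>x. \<phi> (x, \<eta>) * heat_kernel x (A \<eta>) \<partial>lborel)"
proof -
  let ?w = "\<lambda>x t. dt (x, t) * heat_kernel x (A t) + a t * (\<phi> (x, t) * heat_kernel_dt x (A t))"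
  define G where "G z = indicator {\<eta>..T} (snd z) *
    (dt z * heat_kernel (fst z) (A (snd z)) + a (snd z) * (\<phi> z * heat_kernel_dt (fst z) (A (snd z))))" for z
  let ?W = "\<lambda>z. indicator {\<eta>..T} (snd z) * weak_integrand z"
  have G: "integrable (lborel \<Otimes>\<^sub>M lborel) G"
    unfolding G_def by (rule integrable_slab_t_form[OF \<eta>])
  have W: "integrable (lborel \<Otimes>\<^sub>M lborel) ?W"
    by (rule integrable_bounded_mult[OF integrable_weak_integrand, where C = 1]) (auto simp: indicator_def)
  have "(\<integral>z. G z \<partial>(lborel \<Otimes>\<^sub>M lborel)) - (\<integral>z. ?W z \<partial>(lborel \<Otimes>\<^sub>M lborel))
      = (\<integral>z. G z - ?W z \<partial>(lborel \<Otimes>\<^sub>M lborel))"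
    by (rule Bochner_Integration.integral_diff[OF G W, symmetric])
  also have "\<dots> = (\<integral>t. \<integral>x. G (x, t) - ?W (x, t) \<partial>lborel \<partial>lborel)"
    using lborel_pair.integral_snd[of "\<lambda>x t. G (x, t) - ?W (x, t)"] Bochner_Integration.integrable_diff[OF G W]
    by (simp add: case_prod_unfold)
  also have "\<dots> = (\<integral>t. 0 \<partial>(lborel :: real measure))"
  proof (rule Bochner_Integration.integral_cong[OF refl])
    fix t :: real
    show "(\<integral>x. G (x, t) - ?W (x, t) \<partial>lborel) = 0"
    proof (cases "t \<in> {\<eta>..T}")
      case True
      then have A: "0 < A t" using A_pos \<eta> by auto
      have i1: "integrable lborel (\<lambda>x. \<phi> (x, t) * heat_kernel_dt x (A t))"
        using A by (intro test_function_slice_integrable[OF \<phi>] continuous_intros) auto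
      have i2: "integrable lborel (\<lambda>x. x_laplacian \<phi> (x, t) * heat_kernel x (A t))"
        unfolding x_laplacian_def sum_distrib_right using A
        by (intro Bochner_Integration.integrable_sum test_function_slice_integrable[OF xx_test_function] continuous_intros) auto
      have "(\<integral>x. G (x, t) - ?W (x, t) \<partial>lborel) =
         (\<integral>x. a t * (\<phi> (x, t) * heat_kernel_dt x (A t) - x_laplacian \<phi> (x, t) * heat_kernel x (A t)) \<partial>lborel)"
        using True \<eta> by (intro Bochner_Integration.integral_cong[OF refl])
          (auto simp: G_def weak_integrand_def kernel_def algebra_simps)
      also have "\<dots> = 0"
        using heat_kernel_transfer_laplacian[OF \<phi> A, of t] i1 i2 by simp
      finally show ?thesis .
    qed (simp add: G_def)
  qed
  finally have "(\<integral>z. ?W z \<partial>(lborel \<Otimes>\<^sub>M lborel)) = (\<integral>z. G z \<partial>(lborel \<Otimes>\<^sub>M lborel))" by simp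
  also have "\<dots> = (\<integral>x. \<integral>t. G (x, t) \<partial>lborel \<partial>lborel)"
    by (rule lborel_pair.integral_fst'[OF G, symmetric])
  also have "\<dots> = (\<integral>x. - (\<phi> (x, \<eta>) * heat_kernel x (A \<eta>)) \<partial>lborel)"
  proof (rule integral_cong_AE)
    show "(\<lambda>x. \<integral>t. G (x, t) \<partial>lborel) \<in> borel_measurable lborel"
      using lborel_pair.integrable_fst'[OF G] by simp
    show "(\<lambda>x. - (\<phi> (x, \<eta>) * heat_kernel x (A \<eta>))) \<in> borel_measurable lborel"
      using test_function_slice_continuous(1)[OF \<phi>, of UNIV \<eta>, THEN borel_measurable_continuous_onI] by measurable
    show "AE x in lborel. (\<integral>t. G (x, t) \<partial>lborel) = - (\<phi> (x, \<eta>) * heat_kernel x (A \<eta>))"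
      using lborel_pair.AE_integrable_fst'[OF G]
    proof eventually_elim
      case (elim x)
      then have "set_integrable lborel {\<eta>..T} (?w x)"
        by (simp add: set_integrable_def G_def)
      from set_borel_integral_eq_integral(2)[OF this] slice_time_integral[OF \<eta>, of x]
      show ?case by (simp add: set_lebesgue_integral_def G_def)
    qed
  qed
  finally show ?thesis by simp
qed

text \<open>In the limit \<open>\<eta> \<longrightarrow> 0\<close> of \<open>weak_integral_slab\<close> the slabs exhaust the support of the integrand, and the
  boundary term is an approximate identity at the vanishing time \<open>A(\<eta>)\<close>.\<close>

lemma weak_integral_eq: "(\<integral>z. weak_integrand z \<partial>(lborel \<Otimes>\<^sub>M lborel)) = - \<phi> 0"
proof -
  define \<eta> where "\<eta> m = T * inverse (real (Suc m))" for m
  have \<eta>: "0 < \<eta> m" "\<eta> m \<le> T" for m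
    using T_pos by (auto simp: \<eta>_def field_simps)
  have lim: "\<eta> \<longlonglongrightarrow> 0"
    using tendsto_mult_left[OF LIMSEQ_inverse_real_of_nat, of T] by (simp add: \<eta>_def[abs_def])
  have "(\<lambda>m. A (\<eta> m)) \<longlonglongrightarrow> A 0"
    using A_continuous lim T_pos \<eta> less_imp_le[OF \<eta>(1)]
    by (intro continuous_on_tendsto_compose[OF A_continuous lim]) auto
  then have "(\<lambda>m. \<integral>x. \<phi> (x, \<eta> m) * heat_kernel x (A (\<eta> m)) \<partial>lborel) \<longlonglongrightarrow> \<phi> (0, 0)"
    using \<eta> A_pos A_0 by (intro heat_kernel_approximate_identity[OF \<phi> _ _ lim]) auto
  then have "(\<lambda>m. \<integral>z. indicator {\<eta> m..T} (snd z) * weak_integrand z \<partial>(lborel \<Otimes>\<^sub>M lborel)) \<longlonglongrightarrow> - \<phi> (0, 0)"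
    unfolding weak_integral_slab[OF \<eta>] by (rule tendsto_minus)
  moreover have "(\<lambda>m. \<integral>z. indicator {\<eta> m..T} (snd z) * weak_integrand z \<partial>(lborel \<Otimes>\<^sub>M lborel))
      \<longlonglongrightarrow> (\<integral>z. weak_integrand z \<partial>(lborel \<Otimes>\<^sub>M lborel))"
  proof (rule integral_dominated_convergence)
    show "integrable (lborel \<Otimes>\<^sub>M lborel) (\<lambda>z. \<bar>weak_integrand z\<bar>)"
      using integrable_weak_integrand by simp
    show [measurable]: "weak_integrand \<in> borel_measurable (lborel \<Otimes>\<^sub>M lborel)"
      using integrable_weak_integrand by simp
    show "(\<lambda>z. indicator {\<eta> m..T} (snd z) * weak_integrand z) \<in> borel_measurable (lborel \<Otimes>\<^sub>M lborel)" for m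
      by measurable
    show "AE z in lborel \<Otimes>\<^sub>M lborel. norm (indicator {\<eta> m..T} (snd z) * weak_integrand z) \<le> \<bar>weak_integrand z\<bar>" for m
      by (auto simp: indicator_def)
    show "AE z in lborel \<Otimes>\<^sub>M lborel. (\<lambda>m. indicator {\<eta> m..T} (snd z) * weak_integrand z) \<longlonglongrightarrow> weak_integrand z"
    proof (rule AE_I2)
      fix z :: "(real^'n) \<times> real"
      show "(\<lambda>m. indicator {\<eta> m..T} (snd z) * weak_integrand z) \<longlonglongrightarrow> weak_integrand z"
      proof (cases "snd z \<in> {0<..T}")
        case True
        then have "\<forall>\<^sub>F m in sequentially. \<eta> m < snd z" by (intro order_tendstoD(2)[OF lim]) auto
        then have "\<forall>\<^sub>F m in sequentially. indicator {\<eta> m..T} (snd z) * weak_integrand z = weak_integrand z"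
          by eventually_elim (use True in auto)
        then show ?thesis by (rule tendsto_eventually)
      next
        case False
        then have "weak_integrand z = 0" by (simp add: weak_integrand_def kernel_def)
        then show ?thesis by simp
      qed
    qed
  qed
  ultimately show ?thesis using LIMSEQ_unique by (auto simp: zero_prod_def)
qed

lemma weak_equation:
  "(\<integral>z. dt z * kernel z \<partial>(lborel \<Otimes>\<^sub>M lborel)) +
   (\<integral>z. x_laplacian \<phi> z * (a (snd z) * kernel z) \<partial>(lborel \<Otimes>\<^sub>M lborel)) = - \<phi> 0"
  using weak_integral_eq integrable_dt integrable_laplacian by (simp add: weak_integrand_def)

end

end

section \<open>The fundamental solution\<close>

theorem lemma2p1:
  fixes T :: real and a :: "real \<Rightarrow> real"
  assumes "0 < T"
    and "2 \<le> CARD('n::finite)"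
    and "set_integrable lebesgue {0..T} a"
    and "\<And>t. 0 < t \<Longrightarrow> t \<le> T \<Longrightarrow> 0 < primitive0 a t"
  shows "(\<forall>(x :: real ^ 'n) t. t < T \<longrightarrow>
            heat_kernel_coeff a x t =
              heaviside t * exp (- (norm x)\<^sup>2 / (4 * primitive0 a t)) /
              (4 * pi * primitive0 a t) powr (real CARD('n) / 2))
         \<and> fundamental_solution T a (\<lambda>(x :: real ^ 'n, t). heat_kernel_coeff a x t)"
proof (intro conjI allI impI heat_kernel_coeff_formula)
  have "(\<lambda>t. indicator {0..T} t *\<^sub>R a t) \<in> borel_measurable lebesgue"
    using assms(3) unfolding set_integrable_def by simp
  from completion_ex_borel_measurable_real[OF this]
  \<comment> \<open>A Borel representative of \<open>a\<close>, continued by 0 off \<open>[0, T]\<close>.\<close>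
  obtain a' where a'_m: "a' \<in> borel_measurable lborel"
    and a'_ae: "AE t in lborel. indicator {0..T} t *\<^sub>R a t = a' t" by blast
  have a'_int: "integrable lborel a'"
  proof -
    have "integrable lebesgue a'"
      by (rule integrable_cong_AE_imp[OF assms(3)[unfolded set_integrable_def] measurable_completion[OF a'_m] AE_completion[OF a'_ae]])
    then show ?thesis using a'_m by (simp add: integrable_completion)
  qed
  have a'_abs: "a' absolutely_integrable_on {u..v}" for u v
  proof -
    have "integrable lebesgue a'" using a'_int by (simp add: integrable_completion)
    then show ?thesis unfolding set_integrable_def by (intro integrable_mult_indicator) auto
  qed
  have prim: "primitive0 a t = integral {0..t} a'" if "t \<le> T" for t
  proof -
    have "primitive0 a t = (LINT r:{0..t}|lebesgue. a' r)"
      unfolding primitive0_def set_lebesgue_integral_def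
    proof (rule integral_cong_AE)
      have "set_integrable lebesgue {0..t} a"
        by (rule set_integrable_subset[OF assms(3)]) (use that in auto)
      then show "(\<lambda>r. indicat_real {0..t} r *\<^sub>R a r) \<in> borel_measurable lebesgue"
        unfolding set_integrable_def by simp
      show "(\<lambda>r. indicat_real {0..t} r *\<^sub>R a' r) \<in> borel_measurable lebesgue"
        using a'_abs[of 0 t] unfolding set_integrable_def by simp
      show "AE r in lebesgue. indicat_real {0..t} r *\<^sub>R a r = indicat_real {0..t} r *\<^sub>R a' r"
        using AE_completion[OF a'_ae] by eventually_elim (use that in \<open>auto simp: indicator_def split: if_splits\<close>)
    qed
    then show ?thesis using set_lebesgue_integral_eq_integral(2)[OF a'_abs[of 0 t]] by simp
  qed
  have prim_diff: "integral {0..t} a' - integral {0..s} a' = integral {s..t} a'" if "0 \<le> s" "s \<le> t" for s t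
    using Henstock_Kurzweil_Integration.integral_combine[OF that, of a'] a'_abs[of 0 t]
    by (simp add: absolutely_integrable_on_def)
  define A where "A t = indicator {0..T} t *\<^sub>R integral {0..t} a'" for t
  interpret positive_primitive T a' A
  proof
    show "A \<in> borel_measurable borel"
      unfolding A_def[abs_def]
      by (intro borel_measurable_continuous_on_indicator indefinite_integral_continuous_1)
        (use a'_abs in \<open>auto simp: absolutely_integrable_on_def\<close>)
    show "0 < A t" if "0 < t" "t \<le> T" for t
      using that assms(4)[of t] by (simp add: A_def prim)
    show "A t - A s = integral {s..t} a'" if "0 \<le> s" "s \<le> t" "t \<le> T" for s t
      using that prim_diff[of s t] by (simp add: A_def)
  qed (use assms(1) a'_int in \<open>auto simp: A_def\<close>)
  let ?\<Omega> = "(UNIV :: (real^'n) set) \<times> {..<T}"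
  let ?\<epsilon> = "\<lambda>(x :: real^'n, t). heat_kernel_coeff a x t"
  let ?a\<epsilon> = "\<lambda>(x :: real^'n, t). a t * ?\<epsilon> (x, t)"
  have \<Omega>: "?\<Omega> \<in> sets lebesgue" by (intro sets_completionI_sets) (simp add: open_Times borel_open)
  have \<epsilon>_eq: "?\<epsilon> z = kernel z" if "snd z < T" for z
  proof (cases "0 < snd z")
    case True
    then show ?thesis using that prim[of "snd z"]
      by (simp add: case_prod_unfold heat_kernel_coeff_def kernel_def A_def)
  next
    case False
    then have "heaviside (snd z) = 0" by (simp add: heaviside_def)
    then show ?thesis using that False heat_kernel_coeff_formula[OF assms(4), of T "snd z" "fst z"]
      by (simp add: case_prod_unfold kernel_def)
  qed
  \<comment> \<open>The kernels agree off the null hyperplane \<open>t = T\<close>, where one is cut off and the other is not.\<close>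
  have not_T: "AE z :: (real^'n) \<times> real in lborel. snd z \<noteq> T"
    by (rule AE_lborel_prod_snd[OF AE_lborel_singleton])
  have ae\<epsilon>: "AE z in lborel. kernel z = indicator ?\<Omega> z * ?\<epsilon> z"
    using not_T
  proof eventually_elim
    case (elim z)
    then show ?case using \<epsilon>_eq[of z] by (cases z) (auto simp: indicator_def kernel_def)
  qed
  have aea\<epsilon>: "AE z in lborel. a' (snd z) * kernel z = indicator ?\<Omega> z * ?a\<epsilon> z"
    using ae\<epsilon> AE_lborel_prod_snd[OF a'_ae]
  proof eventually_elim
    case (elim z)
    have "indicator ?\<Omega> z * ?a\<epsilon> z = a (snd z) * kernel z"
      unfolding elim(1) by (cases z) simp
    moreover have "kernel z = 0 \<or> a (snd z) = a' (snd z)"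
      using elim(2) by (cases "snd z \<in> {0<..T}") (auto simp: kernel_def)
    ultimately show ?case by auto
  qed
  have set_int: "set_integrable lebesgue ?\<Omega> f"
    if g: "integrable (lborel \<Otimes>\<^sub>M lborel) g" and ae: "AE z in lborel. g z = indicator ?\<Omega> z * f z"
    for f g :: "(real^'n) \<times> real \<Rightarrow> real"
  proof -
    have gi: "integrable lebesgue g" using g by (simp add: lborel_prod integrable_completion)
    have ae': "AE z in lebesgue. g z = indicator ?\<Omega> z *\<^sub>R f z" using AE_completion[OF ae] by simp
    show ?thesis unfolding set_integrable_def
      by (rule integrable_cong_AE_imp[OF gi borel_measurable_AE[OF borel_measurable_integrable[OF gi] ae'] ae'])
  qed
  have i1: "set_integrable lebesgue ?\<Omega> ?\<epsilon>" by (rule set_int[OF integrable_kernel ae\<epsilon>])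
  have i2: "set_integrable lebesgue ?\<Omega> ?a\<epsilon>"
    by (rule set_int[OF integrable_times_kernel[OF a'_int] aea\<epsilon>])
  have eq: "dist_t_deriv (regular_dist ?\<Omega> ?\<epsilon>) \<phi> - dist_x_laplacian (regular_dist ?\<Omega> ?a\<epsilon>) \<phi> = dist_tensor dirac dirac \<phi>"
    if \<phi>: "\<phi> \<in> test_functions ?\<Omega>" for \<phi>
  proof -
    let ?xx = "\<lambda>i. partial_deriv (axis i 1, 0) (partial_deriv (axis i 1, 0) \<phi>)"
    \<comment> \<open>Integrability of each summand allows the exchange of the sum over \<open>i\<close> with the integral.\<close>
    have ixx: "integrable lborel (\<lambda>z. ?xx i z * (a' (snd z) * kernel z))" for i
    proof -
      obtain C where "\<And>z. \<bar>?xx i z\<bar> \<le> C" by (rule test_function_bounded[OF xx_test_function[OF \<phi>]]) blast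
      then show ?thesis unfolding lborel_prod[symmetric]
        by (intro integrable_bounded_mult[where C = C] integrable_times_kernel[OF a'_int]
            measurable_pair_continuous test_function_continuous[OF xx_test_function[OF \<phi>]])
    qed
    have t: "regular_dist ?\<Omega> ?\<epsilon> (partial_deriv (0, 1) \<phi>) = (\<integral>z. partial_deriv (0, 1) \<phi> z * kernel z \<partial>lborel)"
      using integrable_dt[OF \<phi>] ae\<epsilon>
      by (intro regular_dist_cong_lborel) (auto simp: lborel_prod elim!: AE_mp)
    have x: "regular_dist ?\<Omega> ?a\<epsilon> (?xx i) = (\<integral>z. ?xx i z * (a' (snd z) * kernel z) \<partial>lborel)" for i
      using ixx aea\<epsilon> by (intro regular_dist_cong_lborel) (auto elim!: AE_mp)
    have "dist_x_laplacian (regular_dist ?\<Omega> ?a\<epsilon>) \<phi> = (\<Sum>i\<in>UNIV. regular_dist ?\<Omega> ?a\<epsilon> (?xx i))"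
      by (simp add: dist_x_laplacian_def dist_partial_def)
    also have "\<dots> = (\<integral>z. x_laplacian \<phi> z * (a' (snd z) * kernel z) \<partial>lborel)"
      unfolding x x_laplacian_def sum_distrib_right
      by (rule Bochner_Integration.integral_sum[symmetric, OF ixx])
    finally show ?thesis
      using weak_equation[OF \<phi>] t
      by (simp add: dist_t_deriv_def dist_partial_def dist_tensor_def dirac_def lborel_prod zero_prod_def)
  qed
  show "fundamental_solution T a ?\<epsilon>"
    using regular_distribution[OF \<Omega> i1] regular_distribution[OF \<Omega> i2] eq
    unfolding fundamental_solution_def Let_def by simp
qed (use assms in auto)

end
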